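(* For every integer $n\ge 3$ and every real $r>1$, unit balls can cover the sphere $S_r^n$ with density $$\vartheta(S_r^n)\;\le\;\left(\frac12+\frac{3\ln\ln n}{\ln n}+\frac{3}{\ln n}\right)n\ln n .$$
   Context: $S_r^n=\{\mathbf z\in\mathbb R^{n+1}: \sum_{i=1}^{n+1} z_i^2=r^2\}$ is the sphere of radius $r$ centered at the origin $\mathbf 0$ (an $n$-dimensional surface), and $|\cdot|$ denotes $n$-dimensional surface measure on it. $B_1^{n+1}(\mathbf x)$ is the closed unit ball of $\mathbb R^{n+1}$ centered at $\mathbf x$. A unit covering of $S_r^n$ is a finite collection $\mathrm{Cov}$ of centers $\mathbf x\in\mathbb R^{n+1}$ with $S_r^n\subseteq\bigcup_{\mathbf x\in \mathrm{Cov}}B_1^{n+1}(\mathbf x)$. All centers are assumed to satisfy $\|\mathbf x\|=\sqrt{r^2-1}$, so that each ball meets the sphere in the largest possible cap, namely a spherical cap of half-chord $1$: the set of points of $S_r^n$ whose angle (seen from $\mathbf 0$) with the cap's center $\mathbf y\in S_r^n$ is at most $\arcsin(1/r)$. The minimum covering density is $$\vartheta(S_r^n)=\min_{\mathrm{Cov}}\ \sum_{\mathbf x\in \mathrm{Cov}}\frac{|B_1^{n+1}(\mathbf x)\cap S_r^n|}{|S_r^n|},$$ the minimum being over all such unit coverings; equivalently, it is the minimum number of caps of half-chord $1$ needed to cover $S_r^n$, multiplied by the fraction of the surface of $S_r^n$ occupied by one such cap. *)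

theory Defs
  imports "HOL-Analysis.Analysis"
begin

text \<open>
  The surface measure of the sphere of radius \<open>r\<close> about the origin is the spherical factor of Lebesgue
  measure in polar coordinates: the points \<open>t *\<^sub>R z\<close> with \<open>z \<in> A\<close> and \<open>0 < t \<le> 1\<close> form the cone over
  \<open>A\<close>, whose layer at distance \<open>s = t * r\<close> from the origin has surface measure \<open>(s / r) ^ (d - 1) * \<bar>A\<bar>\<close>,
  with \<open>d\<close> the dimension of the space. Integrating over \<open>0 < s \<le> r\<close> gives the volume
  \<open>r / d * \<bar>A\<bar>\<close>. The definition is meant for measurable subsets \<open>A\<close> of the sphere.
\<close>

definition surface_measure :: "real \<Rightarrow> 'a::euclidean_space set \<Rightarrow> real" where
  "surface_measure r A =
     real DIM('a) / r * measure lebesgue {t *\<^sub>R z | t z. 0 < t \<and> t \<le> 1 \<and> z \<in> A}"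

definition unit_covering :: "real \<Rightarrow> 'a::euclidean_space set \<Rightarrow> bool" where
  "unit_covering r Cov \<longleftrightarrow>
     finite Cov \<and> (\<forall>x\<in>Cov. norm x = sqrt (r\<^sup>2 - 1)) \<and> sphere 0 r \<subseteq> (\<Union>x\<in>Cov. cball x 1)"

definition covering_density :: "real \<Rightarrow> 'a::euclidean_space set \<Rightarrow> real" where
  "covering_density r Cov =
     (\<Sum>x\<in>Cov. surface_measure r (cball x 1 \<inter> sphere 0 r)
              / surface_measure r (sphere 0 r :: 'a set))"

text \<open>
  The type argument fixes the ambient space, so for \<open>DIM('a) = n + 1\<close> this is the minimum covering
  density of an \<open>n\<close>-dimensional sphere. The infimum is a minimum, see
  \<open>min_covering_density_attained\<close> below.
\<close>

definition min_covering_density :: "'a::euclidean_space itself \<Rightarrow> real \<Rightarrow> real" where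
  "min_covering_density T r =
     (INF Cov\<in>{Cov :: 'a set. unit_covering r Cov}. covering_density r Cov)"


subsection \<open>The surface measure of the whole sphere\<close>

lemma surface_measure_sphere:
  assumes "r > 0"
  shows "surface_measure r (sphere 0 r :: 'a::euclidean_space set)
           = real DIM('a) * unit_ball_vol (real DIM('a)) * r ^ (DIM('a) - 1)"
proof -
  have "{t *\<^sub>R z | t z. 0 < t \<and> t \<le> 1 \<and> z \<in> sphere (0::'a) r} = cball 0 r - {0}"
  proof (intro equalityI subsetI)
    fix x assume "x \<in> {t *\<^sub>R z | t z. 0 < t \<and> t \<le> 1 \<and> z \<in> sphere (0::'a) r}"
    then obtain t z where "x = t *\<^sub>R z" "0 < t" "t \<le> 1" "norm z = r" by auto
    then show "x \<in> cball 0 r - {0}" using assms by (auto simp: mult_left_le_one_le)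
  next
    fix x assume x: "x \<in> cball (0::'a) r - {0}"
    show "x \<in> {t *\<^sub>R z | t z. 0 < t \<and> t \<le> 1 \<and> z \<in> sphere (0::'a) r}"
      using x assms
      by (intro CollectI exI[of _ "norm x / r"] exI[of _ "(r / norm x) *\<^sub>R x"]) auto
  qed
  moreover have "measure lebesgue (cball (0::'a) r - {0}) = measure lebesgue (cball (0::'a) r)"
    by (rule measure_negligible_symdiff) (auto intro: negligible_subset[of "{0}"])
  moreover have "r ^ DIM('a) = r * r ^ (DIM('a) - 1)"
    by (metis DIM_positive power_eq_if not_less_zero)
  ultimately show ?thesis
    using assms by (simp add: surface_measure_def content_cball)
qed


subsection \<open>Existence of a unit covering of minimum density\<close>

lemma emeasure_lborel_orthogonal_image_le:
  fixes f :: "'a::euclidean_space \<Rightarrow> 'a"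
  assumes f: "orthogonal_transformation f" and U: "open U" and fU: "open (f ` U)"
  shows "emeasure lborel U \<le> emeasure lborel (f ` U)"
proof -
  define K where "K = {(x, d). 0 < d \<and> ball x d \<subseteq> U}"
  obtain C where C: "countable C" "C \<subseteq> K"
     "pairwise (\<lambda>i j. disjnt (ball (fst i) (snd i)) (ball (fst j) (snd j))) C"
     "negligible (U - (\<Union>i\<in>C. ball (fst i) (snd i)))"
  proof (rule Vitali_covering_theorem_balls[of U K fst snd])
    fix x d :: real and y assume "y \<in> U" "0 < d"
    obtain e where "e > 0" "ball y e \<subseteq> U" using U \<open>y \<in> U\<close> openE by blast
    then show "\<exists>i. i \<in> K \<and> y \<in> ball (fst i) (snd i) \<and> snd i < d"
      using \<open>0 < d\<close>
      by (intro exI[of _ "(y, min e (d / 2))"]) (auto simp: K_def subset_iff)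
  qed blast
  define B where "B = (\<lambda>i::'a \<times> real. ball (fst i) (snd i))"
  define B' where "B' = (\<lambda>i::'a \<times> real. ball (f (fst i)) (snd i))"
  have B': "B' i = f ` B i" for i
    by (simp add: B_def B'_def image_orthogonal_transformation_ball[OF f])
  have "inj f" using f by (rule orthogonal_transformation_inj)
  have disj: "disjoint_family_on B C"
    using C(3) by (auto simp: disjoint_family_on_def pairwise_def disjnt_def B_def)
  then have disj': "disjoint_family_on B' C"
    unfolding disjoint_family_on_def B' using \<open>inj f\<close> by (metis image_Int image_empty)
  have sub: "(\<Union>i\<in>C. B i) \<subseteq> U"
    using C(2) by (auto simp: K_def B_def subset_iff)
  have open_B: "open (\<Union>i\<in>C. B i)" "open (\<Union>i\<in>C. B' i)" by (auto simp: B_def B'_def)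
  have "U - (\<Union>i\<in>C. B i) \<in> null_sets lborel"
    using C(4) U open_B by (auto simp: negligible_iff_null_sets null_sets_completion_iff B_def)
  then have "emeasure lborel U = emeasure lborel (\<Union>i\<in>C. B i)"
    using emeasure_Un_null_set[of "\<Union>i\<in>C. B i" lborel "U - (\<Union>i\<in>C. B i)"] sub open_B
    by (simp add: Un_absorb1)
  also have "\<dots> = (\<integral>\<^sup>+i. emeasure lborel (B i) \<partial>count_space C)"
    by (rule emeasure_UN_countable) (use C disj in \<open>auto simp: B_def\<close>)
  also have "\<dots> = (\<integral>\<^sup>+i. emeasure lborel (B' i) \<partial>count_space C)"
    by (rule nn_integral_cong)
      (use C(2) in \<open>auto simp: B_def B'_def K_def emeasure_ball less_imp_le\<close>)
  also have "\<dots> = emeasure lborel (\<Union>i\<in>C. B' i)"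
    by (rule emeasure_UN_countable[symmetric]) (use C disj' in \<open>auto simp: B'_def\<close>)
  also have "\<dots> \<le> emeasure lborel (f ` U)"
    by (rule emeasure_mono) (use sub fU in \<open>auto simp: B'\<close>)
  finally show ?thesis .
qed

lemma distr_lborel_orthogonal_transformation:
  fixes f :: "'a::euclidean_space \<Rightarrow> 'a"
  assumes f: "orthogonal_transformation f"
  shows "distr lborel borel f = lborel"
proof (rule lborel_eqI[symmetric])
  have inv: "orthogonal_transformation (inv f)" and bij: "bij f"
    using f by (auto simp: orthogonal_transformation_inv orthogonal_transformation_bij)
  have cont: "continuous_on UNIV g" if "orthogonal_transformation g" for g :: "'a \<Rightarrow> 'a"
    using that by (simp add: linear_continuous_on linear_linear orthogonal_transformation_linear)
  fix l u :: 'a assume lu: "\<And>b. b \<in> Basis \<Longrightarrow> l \<bullet> b \<le> u \<bullet> b"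
  have vim: "f -` box l u = inv f ` box l u"
    using bij by (simp add: bij_vimage_eq_inv_image)
  have op: "open (inv f ` box l u)"
    using cont[OF f] vim open_vimage[OF open_box] by metis
  have img: "f ` inv f ` box l u = box l u"
    using bij by (simp add: image_image bij_is_surj surj_f_inv_f)
  have "emeasure (distr lborel borel f) (box l u) = emeasure lborel (inv f ` box l u)"
    using cont[OF f] by (subst emeasure_distr) (auto simp: vim borel_measurable_continuous_onI)
  also have "\<dots> = emeasure lborel (box l u)"
    using emeasure_lborel_orthogonal_image_le[OF f op, unfolded img, OF open_box]
      emeasure_lborel_orthogonal_image_le[OF inv open_box op] by (rule antisym)
  finally show "emeasure (distr lborel borel f) (box l u) = (\<Prod>b\<in>Basis. (u - l) \<bullet> b)"
    using lu by (simp add: emeasure_lborel_box)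
qed auto

lemma reflection_exists:
  fixes x y :: "'a::euclidean_space"
  assumes "norm x = norm y"
  obtains f where "orthogonal_transformation f" "f x = y" "f \<circ> f = id"
proof (cases "x = y")
  case True
  then show ?thesis using that[of id] by (simp add: orthogonal_transformation_def linear_id id_def comp_def)
next
  case False
  define w where "w = x - y"
  define f where "f = (\<lambda>z. z - (2 * (w \<bullet> z) / (w \<bullet> w)) *\<^sub>R w)"
  have ww: "w \<bullet> w \<noteq> 0" using False by (simp add: w_def)
  have "linear f"
    by (rule linearI) (simp_all add: f_def inner_right_distrib algebra_simps add_divide_distrib)
  moreover have "f v \<bullet> f v' = v \<bullet> v'" for v v'
    using ww by (simp add: f_def inner_diff_left inner_diff_right inner_commute field_simps)
  ultimately have "orthogonal_transformation f" by (simp add: orthogonal_transformation_def)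
  moreover have "f x = y"
  proof -
    have "x \<bullet> x = y \<bullet> y" using assms by (simp add: norm_eq)
    then have "2 * (w \<bullet> x) = w \<bullet> w"
      by (simp add: w_def inner_diff_left inner_diff_right inner_commute)
    then show ?thesis using ww by (simp add: f_def w_def)
  qed
  moreover have "f \<circ> f = id"
    using ww by (auto simp: f_def fun_eq_iff inner_diff_right)
  ultimately show ?thesis using that by blast
qed

lemma surface_measure_orthogonal_image:
  fixes f :: "'a::euclidean_space \<Rightarrow> 'a"
  assumes f: "orthogonal_transformation f" and A: "compact A"
  shows "surface_measure r (f ` A) = surface_measure r A"
proof -
  define cone where "cone = (\<lambda>A::'a set. {t *\<^sub>R z | t z. 0 < t \<and> t \<le> 1 \<and> z \<in> A})"
  define cone0 where "cone0 = (\<lambda>A::'a set. (\<lambda>(t, z). t *\<^sub>R z) ` ({0..1::real} \<times> A))"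
  have lin: "linear f" using f by (rule orthogonal_transformation_linear)
  have bij: "bij f" using f by (rule orthogonal_transformation_bij)
  have cont: "continuous_on S f" for S
    using lin by (simp add: linear_continuous_on linear_linear)
  have cpt: "compact (cone0 A)" if "compact A" for A
    unfolding cone0_def
    by (intro compact_continuous_image compact_Times that compact_Icc)
      (auto simp: case_prod_beta intro!: continuous_intros)
  have eq: "measure lebesgue (cone A) = measure lborel (cone0 A)" if "compact A" for A
  proof -
    have "cone A \<subseteq> cone0 A" "cone0 A \<subseteq> insert 0 (cone A)"
    proof -
      show "cone A \<subseteq> cone0 A"
      proof
        fix v assume "v \<in> cone A"
        then obtain t z where "v = t *\<^sub>R z" "0 < t" "t \<le> 1" "z \<in> A" by (auto simp: cone_def)
        then show "v \<in> cone0 A" unfolding cone0_def by (intro image_eqI[of _ _ "(t, z)"]) auto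
      qed
      show "cone0 A \<subseteq> insert 0 (cone A)"
      proof
        fix v assume "v \<in> cone0 A"
        then obtain t z where "v = t *\<^sub>R z" "0 \<le> t" "t \<le> 1" "z \<in> A" by (auto simp: cone0_def)
        then show "v \<in> insert 0 (cone A)" by (cases "t = 0") (auto simp: cone_def)
      qed
    qed
    then have "cone0 A = cone A \<or> cone0 A = insert 0 (cone A)" by blast
    then have "measure lebesgue (cone A) = measure lebesgue (cone0 A)"
      by (intro measure_negligible_symdiff) (auto intro: negligible_subset[of "{0}"]
          simp: fmeasurableD lmeasurable_compact cpt that)
    then show ?thesis using cpt[OF that] by (simp add: borel_compact measure_completion)
  qed
  have img: "f ` cone0 A = cone0 (f ` A)"
  proof -
    have "f (case p of (t, z) \<Rightarrow> t *\<^sub>R z) = (case map_prod id f p of (t, z) \<Rightarrow> t *\<^sub>R z)" for p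
      using lin by (cases p) (simp add: linear_scale)
    moreover have "{0..1} \<times> f ` A = map_prod id f ` ({0..1::real} \<times> A)"
      by (simp add: map_prod_surj_on)
    ultimately show ?thesis by (simp add: cone0_def image_image)
  qed
  have "measure lborel (cone0 (f ` A)) = measure (distr lborel borel f) (cone0 (f ` A))"
    by (simp add: distr_lborel_orthogonal_transformation[OF f])
  also have "\<dots> = measure lborel (f -` cone0 (f ` A))"
    using cont cpt[OF compact_continuous_image[OF cont A]]
    by (subst measure_distr) (auto simp: borel_measurable_continuous_onI borel_compact)
  also have "f -` cone0 (f ` A) = cone0 A"
    using bij by (simp flip: img add: inj_vimage_image_eq bij_is_inj)
  finally show ?thesis
    using eq[OF A] eq[OF compact_continuous_image[OF cont A]]
    by (simp add: surface_measure_def cone_def)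
qed

lemma surface_measure_cap_cong:
  fixes x y :: "'a::euclidean_space"
  assumes "norm x = norm y"
  shows "surface_measure r (cball x 1 \<inter> sphere 0 r) = surface_measure r (cball y 1 \<inter> sphere 0 r)"
proof -
  obtain f where f: "orthogonal_transformation f" "f x = y" "f \<circ> f = id"
    using reflection_exists[OF assms] .
  have "f ` sphere 0 r = sphere 0 r"
  proof (intro equalityI subsetI)
    fix z :: 'a assume "z \<in> sphere 0 r"
    then show "z \<in> f ` sphere 0 r"
      using f by (intro image_eqI[of _ _ "f z"])
        (auto simp: orthogonal_transformation_norm fun_eq_iff)
  qed (use f in \<open>auto simp: orthogonal_transformation_norm\<close>)
  then have "f ` (cball x 1 \<inter> sphere 0 r) = cball y 1 \<inter> sphere 0 r"
    using f by (simp add: image_Int orthogonal_transformation_inj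
        image_orthogonal_transformation_cball)
  moreover have "compact (cball x 1 \<inter> sphere 0 r)" by (simp add: compact_Int)
  ultimately show ?thesis using surface_measure_orthogonal_image[OF f(1)] by metis
qed

lemma unit_covering_exists:
  assumes "r > 1"
  shows "\<exists>Cov :: 'a::euclidean_space set. unit_covering r Cov"
proof -
  define q where "q = sqrt (r\<^sup>2 - 1)"
  have "r\<^sup>2 - 1 > 0" using assms by (simp add: power2_eq_square less_1_mult)
  have "r - 1 < q"
    unfolding q_def using assms by (intro real_less_rsqrt) (simp add: power2_eq_square algebra_simps)
  moreover have "q < r"
    unfolding q_def using assms \<open>r\<^sup>2 - 1 > 0\<close> by (intro real_less_lsqrt) auto
  ultimately have q: "r - 1 < q" "q < r" "0 \<le> q"
    using assms by auto
  define c where "c = (\<lambda>y::'a. (q / r) *\<^sub>R y)"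
  have near: "y \<in> ball (c y) 1" if "y \<in> sphere 0 r" for y
  proof -
    have "c y - y = (q / r - 1) *\<^sub>R y" by (simp add: c_def algebra_simps)
    then have "dist (c y) y = \<bar>q / r - 1\<bar> * r" using that by (simp add: dist_norm)
    also have "\<dots> = r - q" using q assms by (simp add: abs_if field_simps)
    finally show ?thesis using q by simp
  qed
  obtain D where D: "D \<subseteq> sphere 0 r" "finite D" "sphere 0 r \<subseteq> (\<Union>y\<in>D. ball (c y) 1)"
    by (rule compactE_image[of "sphere 0 r" "sphere 0 r" "\<lambda>y. ball (c y) 1"]) (use near in auto)
  have "norm (c y) = q" if "y \<in> D" for y
    using that D q assms by (auto simp: c_def)
  moreover have "sphere 0 r \<subseteq> (\<Union>x\<in>c ` D. cball x 1)"
  proof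
    fix z :: 'a assume "z \<in> sphere 0 r"
    then obtain y where "y \<in> D" "z \<in> ball (c y) 1" using D(3) by blast
    then show "z \<in> (\<Union>x\<in>c ` D. cball x 1)" by (intro UN_I[of "c y"]) auto
  qed
  ultimately have "unit_covering r (c ` D)"
    using D(2) by (auto simp: unit_covering_def q_def)
  then show ?thesis ..
qed

theorem min_covering_density_attained:
  assumes "r > 1"
  shows "\<exists>Cov :: 'a::euclidean_space set. unit_covering r Cov
           \<and> covering_density r Cov = min_covering_density TYPE('a) r
           \<and> (\<forall>Cov' :: 'a set. unit_covering r Cov' \<longrightarrow> covering_density r Cov \<le> covering_density r Cov')"
proof -
  obtain Cov :: "'a set" where Cov: "unit_covering r Cov"
    and least: "\<And>Cov'. unit_covering r Cov' \<Longrightarrow> card Cov \<le> card (Cov' :: 'a set)"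
    using ex_has_least_nat[of "unit_covering r" _ card] unit_covering_exists[OF assms] by metis
  define \<delta> where "\<delta> = (\<lambda>x::'a. surface_measure r (cball x 1 \<inter> sphere 0 r)
                                / surface_measure r (sphere 0 r :: 'a set))"
  have nonneg: "\<delta> x \<ge> 0" for x
    using assms by (simp add: \<delta>_def surface_measure_def)
  have "Cov \<noteq> {}"
    using Cov assms by (auto simp: unit_covering_def)
  then obtain x0 where x0: "x0 \<in> Cov" by blast
  have card: "covering_density r Cov' = real (card Cov') * \<delta> x0" if "unit_covering r Cov'"
    for Cov' :: "'a set"
  proof -
    have "\<delta> x = \<delta> x0" if "x \<in> Cov'" for x
      using surface_measure_cap_cong[of x x0 r] \<open>unit_covering r Cov'\<close> that x0 Cov
      by (simp add: \<delta>_def unit_covering_def)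
    then have "(\<Sum>x\<in>Cov'. \<delta> x) = real (card Cov') * \<delta> x0" by simp
    then show ?thesis by (simp add: covering_density_def \<delta>_def)
  qed
  have le: "covering_density r Cov \<le> covering_density r Cov'" if "unit_covering r Cov'"
    for Cov' :: "'a set"
    using card[OF Cov] card[OF that] least[OF that] nonneg by (simp add: mult_right_mono)
  have "min_covering_density TYPE('a) r = covering_density r Cov"
    unfolding min_covering_density_def by (rule cInf_eq_minimum) (use Cov le in auto)
  then show ?thesis using Cov le by metis
qed

end

theory Submission
  imports Defs "HOL-Probability.Probability"
begin

text \<open>
  Scaled to the unit sphere, the balls become caps of angular radius \<open>\<phi> = arcsin (1 / r)\<close>, and the density
  is the number of caps times the fraction \<open>V \<phi>\<close> of the sphere that one of them occupies. The derivative
  of \<open>V\<close> is a multiple of \<open>sin \<phi> ^ (n - 1)\<close>, so \<open>V \<phi> / \<phi> ^ n\<close> decreases and \<open>V \<phi> / sin \<phi> ^ n\<close> increases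
  (\<open>cap_fraction_ratio_angle\<close>, \<open>cap_fraction_ratio_sin\<close>). All volumes are compared by these two facts,
  which is why the bound does not depend on \<open>r\<close>.

  One scale (\<open>one_scale_covering\<close>). This is the argument of Rogers. Caps of angle \<open>(1 - \<eta>) \<phi>\<close> around \<open>N\<close>
  random centers leave at most the fraction \<open>(1 - V ((1 - \<eta>) \<phi>)) ^ N\<close> uncovered on average. The
  points that stay uncovered when the caps grow to the angle \<open>\<phi>\<close> are covered by additional
  caps around a \<open>2 \<eta> \<phi>\<close>-separated set of such points, and there are few of those because the caps of angle
  \<open>\<eta> \<phi>\<close> around them are disjoint and lie in the part missed before. With \<open>\<eta>\<close> about \<open>1 / (n ln n)\<close> the
  density is about \<open>n ln n + n ln ln n\<close>. This is below the claimed bound as long as \<open>ln n \<le> 8\<close>.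

  Two scales (\<open>two_scale_covering\<close>). For larger \<open>n\<close> the leading constant has to drop to \<open>1 / 2\<close>. One scale
  pays \<open>n ln n\<close> because a cap contains about \<open>n ^ n\<close> points of a net with spacing \<open>\<phi> / n\<close>, each of which is
  missed with probability \<open>exp (- \<lambda>)\<close>, where \<open>\<lambda>\<close> is the density of the random caps. A coarser net with
  spacing \<open>\<epsilon>\<close> about \<open>\<phi> / sqrt n\<close> has only about \<open>n ^ (n / 2)\<close> points in a cap, so \<open>\<lambda>\<close> slightly above \<open>n / 2 * ln n\<close>
  suffices to have several centers within nearly \<open>\<phi>\<close> of every coarse point \<open>y\<close>. Such a center \<open>x\<close> need not
  cover all points within \<open>\<epsilon>\<close> of \<open>y\<close>, but it covers most of them: moving from \<open>y\<close> by \<open>\<epsilon>\<close> in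
  a tangent direction \<open>w\<close> changes the distance to \<open>x\<close> by an amount governed by the component of \<open>x\<close> along
  \<open>w\<close>, and in high dimension this component is larger than \<open>sqrt (2 * ln n / n) * sin \<phi>\<close> with probability at most
  \<open>1 / n\<close> (\<open>measure_cap_difference_le\<close>). Hence \<open>n / 2\<close> centers near \<open>y\<close> all miss a given fine net point
  with probability \<open>n ^ (- n / 2)\<close>, and this, times the probability \<open>exp (- \<lambda>)\<close>, compensates for
  the \<open>n ^ n\<close> fine points in a cap. The few coarse points with less than \<open>n / 2\<close> centers nearby
  and the few fine points missed in spite of \<open>n / 2\<close> such centers become additional centers themselves.

  Both numbers of exceptions are bounded by expectations of products over the independent centers, so a good
  choice of the centers is found by fixing one center after the other
  (\<open>exists_points_product_potential\<close>).
\<close>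

section \<open>The volume of a solid cone\<close>

text \<open>
  Fubini along the axis \<open>b\<close>: every slice is a ball of one dimension less.
\<close>

lemma emeasure_solid_of_revolution:
  fixes b :: "'a::euclidean_space" and g :: "real \<Rightarrow> real"
  assumes b: "b \<in> Basis" and [measurable]: "g \<in> borel_measurable borel" "I \<in> sets borel"
    and pos: "\<And>h. h \<in> I \<Longrightarrow> g h > 0"
  shows "emeasure lborel {p. p \<bullet> b \<in> I \<and> norm (p - (p \<bullet> b) *\<^sub>R b) \<le> g (p \<bullet> b)}
    = (\<integral>\<^sup>+h. ennreal (unit_ball_vol (real (DIM('a) - 1)) * g h ^ (DIM('a) - 1)) * indicator I h \<partial>lborel)"
    (is "emeasure lborel ?S = _")
proof -
  interpret product_sigma_finite "\<lambda>_. lborel" by standard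
  define A where "A = Basis - {b}"
  have A: "finite A" "b \<notin> A" "Basis = insert b A" "card A = DIM('a) - 1"
    using b by (auto simp: A_def)
  define T where "T = (\<lambda>f. \<Sum>i\<in>Basis. f i *\<^sub>R i :: 'a)"
  have [measurable]: "T \<in> borel_measurable (Pi\<^sub>M Basis (\<lambda>_. lborel))"
    unfolding T_def by measurable
  have S[measurable]: "?S \<in> sets borel" by measurable
  have T1: "T f \<bullet> b = f b" for f
    unfolding T_def using b by (simp add: inner_sum_left_Basis)
  have T2: "norm (T f - (T f \<bullet> b) *\<^sub>R b) = sqrt (\<Sum>i\<in>A. (f i)\<^sup>2)" for f
  proof -
    have v: "T f - (T f \<bullet> b) *\<^sub>R b = (\<Sum>i\<in>A. f i *\<^sub>R i)"
    proof -
      have "T f = (\<Sum>i\<in>insert b A. f i *\<^sub>R i)" by (simp only: T_def A(3)[symmetric])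
      also have "\<dots> = f b *\<^sub>R b + (\<Sum>i\<in>A. f i *\<^sub>R i)" using A(1,2) by (rule sum.insert)
      finally have "T f - f b *\<^sub>R b = (\<Sum>i\<in>A. f i *\<^sub>R i)" by (simp only: add_diff_cancel_left')
      then show ?thesis by (simp only: T1)
    qed
    have "(norm (\<Sum>i\<in>A. f i *\<^sub>R i))\<^sup>2 = (\<Sum>i\<in>A. (norm (f i *\<^sub>R i))\<^sup>2)"
    proof (rule norm_sum_Pythagorean[OF A(1)])
      show "pairwise (\<lambda>i j. orthogonal (f i *\<^sub>R i) (f j *\<^sub>R j)) A"
        by (auto simp: pairwise_def orthogonal_def A_def inner_Basis)
    qed
    also have "\<dots> = (\<Sum>i\<in>A. (f i)\<^sup>2)"
      by (intro sum.cong) (auto simp: A_def)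
    finally have "sqrt ((norm (\<Sum>i\<in>A. f i *\<^sub>R i))\<^sup>2) = sqrt (\<Sum>i\<in>A. (f i)\<^sup>2)"
      by simp
    then show ?thesis by (simp only: v real_sqrt_abs abs_norm_cancel)
  qed
  have "emeasure lborel ?S = emeasure (distr (Pi\<^sub>M Basis (\<lambda>_. lborel)) borel T) ?S"
    unfolding T_def by (subst lborel_eq) simp
  also have "\<dots> = (\<integral>\<^sup>+f. indicator ?S (T f) \<partial>Pi\<^sub>M Basis (\<lambda>_. lborel))"
    by (simp add: nn_integral_distr flip: nn_integral_indicator)
  also have "\<dots> = (\<integral>\<^sup>+h. \<integral>\<^sup>+f. indicator ?S (T (f(b := h))) \<partial>Pi\<^sub>M A (\<lambda>_. lborel) \<partial>lborel)"
  proof -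
    have "(\<lambda>f. indicator ?S (T f) :: ennreal) \<in> borel_measurable (Pi\<^sub>M Basis (\<lambda>_. lborel))"
      by measurable
    then show ?thesis using A(1,2) unfolding A(3) by (rule product_nn_integral_insert_rev[rotated 2])
  qed
  also have "\<dots> = (\<integral>\<^sup>+h. (\<integral>\<^sup>+f. indicator ({f. sqrt (\<Sum>i\<in>A. (f i)\<^sup>2) \<le> g h} \<inter> space (Pi\<^sub>M A (\<lambda>_. lborel))) f
      * indicator I h \<partial>Pi\<^sub>M A (\<lambda>_. lborel)) \<partial>lborel)"
  proof (intro nn_integral_cong)
    fix h f assume f: "f \<in> space (Pi\<^sub>M A (\<lambda>_. lborel :: real measure))"
    have eq: "(\<Sum>i\<in>A. ((f(b := h)) i)\<^sup>2) = (\<Sum>i\<in>A. (f i)\<^sup>2)"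
      using A by (intro sum.cong) auto
    have "T (f(b := h)) \<in> ?S \<longleftrightarrow> h \<in> I \<and> sqrt (\<Sum>i\<in>A. (f i)\<^sup>2) \<le> g h"
      by (simp only: mem_Collect_eq T2 eq) (simp add: T1)
    then show "indicator ?S (T (f(b := h))) = (indicator ({f. sqrt (\<Sum>i\<in>A. (f i)\<^sup>2) \<le> g h}
        \<inter> space (Pi\<^sub>M A (\<lambda>_. lborel))) f * indicator I h :: ennreal)"
      using f by (auto simp: indicator_def)
  qed
  also have "\<dots> = (\<integral>\<^sup>+h. ennreal (unit_ball_vol (real (DIM('a) - 1)) * g h ^ (DIM('a) - 1)) * indicator I h \<partial>lborel)"
  proof (intro nn_integral_cong)
    fix h :: real
    have "(\<integral>\<^sup>+f. indicator ({f. sqrt (\<Sum>i\<in>A. (f i)\<^sup>2) \<le> g h} \<inter> space (Pi\<^sub>M A (\<lambda>_. lborel))) f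
      * indicator I h \<partial>Pi\<^sub>M A (\<lambda>_. lborel)) =
      emeasure (Pi\<^sub>M A (\<lambda>_. lborel)) ({f. sqrt (\<Sum>i\<in>A. (f i)\<^sup>2) \<le> g h} \<inter> space (Pi\<^sub>M A (\<lambda>_. lborel))) * indicator I h"
      using A by (subst nn_integral_multc) auto
    also have "\<dots> = ennreal (unit_ball_vol (real (DIM('a) - 1)) * g h ^ (DIM('a) - 1)) * indicator I h"
    proof (cases "h \<in> I")
      case True
      with pos[OF this] A show ?thesis by (subst emeasure_cball_aux) auto
    qed auto
    finally show "(\<integral>\<^sup>+f. indicator ({f. sqrt (\<Sum>i\<in>A. (f i)\<^sup>2) \<le> g h} \<inter> space (Pi\<^sub>M A (\<lambda>_. lborel))) f
      * indicator I h \<partial>Pi\<^sub>M A (\<lambda>_. lborel)) = ennreal (unit_ball_vol (real (DIM('a) - 1)) * g h ^ (DIM('a) - 1)) * indicator I h" .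
  qed
  finally show ?thesis .
qed

text \<open>
  The unit ball and the cone around \<open>b\<close> are both rotationally symmetric, so
  on the slice at height \<open>p \<bullet> b\<close> each of the two conditions bounds the distance to the axis.
\<close>

lemma norm_le_and_cone_iff_slice:
  fixes b :: "'a::euclidean_space"
  assumes b: "norm b = 1" and phi: "0 < \<phi>" "\<phi> < pi / 2" and h: "0 < p \<bullet> b" "p \<bullet> b < 1"
  shows "norm p \<le> 1 \<and> cos \<phi> * norm p \<le> p \<bullet> b \<longleftrightarrow>
    norm (p - (p \<bullet> b) *\<^sub>R b) \<le> min (sqrt (1 - (p \<bullet> b)\<^sup>2)) ((p \<bullet> b) * tan \<phi>)"
proof -
  define h where "h = p \<bullet> b"
  define d where "d = norm (p - h *\<^sub>R b)"
  have "b \<bullet> b = 1" using b by (simp add: norm_eq_1)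
  then have d2: "d\<^sup>2 = (norm p)\<^sup>2 - h\<^sup>2"
    unfolding d_def power2_norm_eq_inner
    by (simp add: h_def inner_diff_left inner_diff_right inner_commute power2_eq_square)
  have cs: "cos \<phi> > 0" "sin \<phi> > 0" "tan \<phi> > 0"
    using phi by (auto intro!: cos_gt_zero sin_gt_zero tan_gt_zero)
  have h01: "0 < h" "h < 1" and d0: "d \<ge> 0" using assms by (auto simp: h_def d_def)
  have h2: "h\<^sup>2 < 1" using h01 by (simp add: power_less_one_iff abs_square_less_1)
  have "norm p \<le> 1 \<longleftrightarrow> (norm p)\<^sup>2 \<le> 1" by (simp add: power_le_one_iff)
  also have "\<dots> \<longleftrightarrow> d\<^sup>2 \<le> (sqrt (1 - h\<^sup>2))\<^sup>2" using h2 d2 by simp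
  also have "\<dots> \<longleftrightarrow> d \<le> sqrt (1 - h\<^sup>2)" using d0 h2 by (subst power_mono_iff) auto
  finally have 1: "norm p \<le> 1 \<longleftrightarrow> d \<le> sqrt (1 - h\<^sup>2)" .
  have "cos \<phi> * norm p \<le> h \<longleftrightarrow> (cos \<phi> * norm p)\<^sup>2 \<le> h\<^sup>2"
    using cs h01 by (subst power_mono_iff) auto
  also have "\<dots> \<longleftrightarrow> (cos \<phi>)\<^sup>2 * d\<^sup>2 \<le> (1 - (cos \<phi>)\<^sup>2) * h\<^sup>2"
  proof -
    have "(norm p)\<^sup>2 = d\<^sup>2 + h\<^sup>2" using d2 by simp
    then show ?thesis by (simp add: power_mult_distrib algebra_simps)
  qed
  also have "1 - (cos \<phi>)\<^sup>2 = (sin \<phi>)\<^sup>2" by (simp add: sin_squared_eq)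
  also have "(cos \<phi>)\<^sup>2 * d\<^sup>2 \<le> (sin \<phi>)\<^sup>2 * h\<^sup>2 \<longleftrightarrow> (cos \<phi> * d)\<^sup>2 \<le> (sin \<phi> * h)\<^sup>2"
    by (simp add: power_mult_distrib)
  also have "\<dots> \<longleftrightarrow> cos \<phi> * d \<le> sin \<phi> * h"
    using cs d0 h01 by (subst power_mono_iff) auto
  also have "\<dots> \<longleftrightarrow> d \<le> h * tan \<phi>"
    using cs by (simp add: tan_def field_simps)
  finally show ?thesis using 1 by (simp add: d_def h_def)
qed

text \<open>
  The first summand is the volume of a cone of height \<open>cos \<phi>\<close> over a ball of radius \<open>sin \<phi>\<close>, the
  second one that of the part of the unit ball above the height \<open>cos \<phi>\<close>.
\<close>

definition cap_volume :: "nat \<Rightarrow> real \<Rightarrow> real" where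
  "cap_volume n \<phi> = unit_ball_vol (real n) *
     (sin \<phi> ^ n * cos \<phi> / real (n + 1) + integral {cos \<phi>..1} (\<lambda>h. sqrt (1 - h\<^sup>2) ^ n))"

lemma measure_solid_cone:
  fixes b :: "'a::euclidean_space"
  assumes b: "b \<in> Basis" and dim: "DIM('a) = n + 1" and phi: "0 < \<phi>" "\<phi> < pi / 2"
  shows "measure lborel {p \<in> cball 0 1. cos \<phi> * norm p \<le> p \<bullet> b} = cap_volume n \<phi>"
proof -
  define g where "g = (\<lambda>h. min (sqrt (1 - h\<^sup>2)) (h * tan \<phi>))"
  have [measurable]: "g \<in> borel_measurable borel" unfolding g_def by measurable
  let ?K = "unit_ball_vol (real n)"
  have K: "?K \<ge> 0" by (simp add: unit_ball_vol_def)
  define c where "c = cos \<phi>"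
  have cs: "cos \<phi> > 0" "sin \<phi> > 0" "tan \<phi> > 0"
    using phi by (auto intro!: cos_gt_zero sin_gt_zero tan_gt_zero)
  have c: "0 < c" "c < 1"
    using cs phi cos_monotone_0_pi[of 0 \<phi>] by (auto simp: c_def)
  have gpos: "g h > 0" if "h \<in> {0<..<1}" for h
    using that cs by (auto simp: g_def abs_square_less_1)
  let ?C = "{p \<in> cball (0::'a) 1. cos \<phi> * norm p \<le> p \<bullet> b}"
  let ?S = "{p. p \<bullet> b \<in> {0<..<1} \<and> norm (p - (p \<bullet> b) *\<^sub>R b) \<le> g (p \<bullet> b)}"
  have nb: "norm b = 1" using b by simp
  have S: "?S = ?C - {0, b}"
  proof (intro set_eqI)
    fix p :: 'a
    show "p \<in> ?S \<longleftrightarrow> p \<in> ?C - {0, b}"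
    proof (cases "0 < p \<bullet> b \<and> p \<bullet> b < 1")
      case True
      then have "p \<noteq> 0" "p \<noteq> b" using b by auto
      then show ?thesis using norm_le_and_cone_iff_slice[OF nb phi, of p] True
        by (auto simp: g_def)
    next
      case False
      have "p \<in> {0, b}" if "p \<in> ?C"
      proof (cases "p \<bullet> b \<le> 0")
        case True
        then have "cos \<phi> * norm p \<le> 0" using that by auto
        then show ?thesis using cs by (simp add: mult_le_0_iff)
      next
        case f: False
        then have "1 \<le> p \<bullet> b" using False by auto
        moreover have "norm p \<le> 1" using that by auto
        moreover have "p \<bullet> b \<le> norm p * norm b" by (rule norm_cauchy_schwarz)
        ultimately have "p \<bullet> b = norm p * norm b" "norm p = 1" using nb by auto
        then have "p = b" using nb norm_cauchy_schwarz_eq[of p b] by simp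
        then show ?thesis by simp
      qed
      then show ?thesis using False by auto
    qed
  qed
  have "{0, b} \<in> null_sets lborel" by (intro finite_imp_null_set_lborel) auto
  have [measurable]: "?C \<in> sets borel" by measurable
  have "emeasure lborel ?C = emeasure lborel ?S"
    unfolding S using \<open>{0, b} \<in> null_sets lborel\<close> by (subst emeasure_Diff_null_set) auto
  also have "\<dots> = (\<integral>\<^sup>+h. ennreal (?K * g h ^ n) * indicator {0<..<1} h \<partial>lborel)"
    using emeasure_solid_of_revolution[OF b, of g "{0<..<1}"] gpos dim by simp
  also have "\<dots> = (\<integral>\<^sup>+h. ennreal (?K * (h * tan \<phi>) ^ n) * indicator {0..c} h
      + ennreal (?K * sqrt (1 - h\<^sup>2) ^ n) * indicator {c..1} h \<partial>lborel)"
  proof (intro nn_integral_cong_AE)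
    have "AE h in lborel. h \<notin> {0, c, 1::real}"
      by (intro AE_not_in finite_imp_null_set_lborel) auto
    then show "AE h in lborel. ennreal (?K * g h ^ n) * indicator {0<..<1} h =
      ennreal (?K * (h * tan \<phi>) ^ n) * indicator {0..c} h
      + ennreal (?K * sqrt (1 - h\<^sup>2) ^ n) * indicator {c..1} h"
    proof eventually_elim
      case (elim h)
      \<comment> \<open>The cone and the sphere meet at the height \<open>cos \<phi>\<close>, below which the cone is narrower.\<close>
      have *: "h * tan \<phi> \<le> sqrt (1 - h\<^sup>2) \<longleftrightarrow> h \<le> c" if "0 < h" "h < 1"
      proof -
        have h2: "h\<^sup>2 < 1" using that by (simp add: abs_square_less_1)
        have "h * tan \<phi> \<le> sqrt (1 - h\<^sup>2) \<longleftrightarrow> (h * tan \<phi>)\<^sup>2 \<le> (sqrt (1 - h\<^sup>2))\<^sup>2"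
          using that cs h2 by (subst power_mono_iff) auto
        also have "\<dots> \<longleftrightarrow> h\<^sup>2 * (1 + (tan \<phi>)\<^sup>2) \<le> 1" using h2 by (simp add: algebra_simps)
        also have "1 + (tan \<phi>)\<^sup>2 = 1 / c\<^sup>2"
          using cs tan_sec[of \<phi>] by (simp add: c_def inverse_eq_divide power_divide)
        also have "h\<^sup>2 * (1 / c\<^sup>2) \<le> 1 \<longleftrightarrow> h\<^sup>2 \<le> c\<^sup>2" using c by (simp add: field_simps)
        also have "\<dots> \<longleftrightarrow> h \<le> c" using c that by (subst power_mono_iff) auto
        finally show ?thesis .
      qed
      show ?case
      proof (cases "0 < h \<and> h < 1")
        case True
        then show ?thesis using * elim c by (auto simp: g_def indicator_def min_def)
      next
        case False
        then show ?thesis using elim c by (auto simp: indicator_def)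
      qed
    qed
  qed
  also have "\<dots> = (\<integral>\<^sup>+h. ennreal (?K * (h * tan \<phi>) ^ n) * indicator {0..c} h \<partial>lborel)
      + (\<integral>\<^sup>+h. ennreal (?K * sqrt (1 - h\<^sup>2) ^ n) * indicator {c..1} h \<partial>lborel)"
    by (intro nn_integral_add) auto
  also have "(\<integral>\<^sup>+h. ennreal (?K * (h * tan \<phi>) ^ n) * indicator {0..c} h \<partial>lborel)
     = ennreal (?K * tan \<phi> ^ n * c ^ (n + 1) / real (n + 1) - ?K * tan \<phi> ^ n * 0 ^ (n + 1) / real (n + 1))"
  proof (intro nn_integral_FTC_Icc)
    fix h assume "h \<in> {0..c}"
    then show "0 \<le> ?K * (h * tan \<phi>) ^ n" using cs K by simp
    define m where "m = real (n + 1)"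
    have m: "m \<noteq> 0" unfolding m_def by simp
    have "((\<lambda>h. ?K * tan \<phi> ^ n * h ^ (n + 1) / m) has_real_derivative
        ?K * tan \<phi> ^ n * (m * h ^ n) / m) (at h)"
      using m DERIV_pow[of "n + 1" h]
      by (intro DERIV_cdivide DERIV_cmult) (simp add: m_def)
    moreover have "?K * tan \<phi> ^ n * (m * h ^ n) / m = ?K * (h * tan \<phi>) ^ n"
      using m by (simp add: power_mult_distrib)
    ultimately have "((\<lambda>h. ?K * tan \<phi> ^ n * h ^ (n + 1) / m) has_real_derivative
        ?K * (h * tan \<phi>) ^ n) (at h)" by metis
    then show "((\<lambda>h. ?K * tan \<phi> ^ n * h ^ (n + 1) / real (n + 1)) has_real_derivative
        ?K * (h * tan \<phi>) ^ n) (at h)"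
      unfolding m_def .
  qed (use c in auto)
  also have "?K * tan \<phi> ^ n * c ^ (n + 1) / real (n + 1) - ?K * tan \<phi> ^ n * 0 ^ (n + 1) / real (n + 1)
      = ?K * (sin \<phi> ^ n * cos \<phi> / real (n + 1))"
    using cs by (simp add: c_def tan_def power_divide)
  also have "(\<integral>\<^sup>+h. ennreal (?K * sqrt (1 - h\<^sup>2) ^ n) * indicator {c..1} h \<partial>lborel)
     = ennreal (?K * integral {c..1} (\<lambda>h. sqrt (1 - h\<^sup>2) ^ n))"
  proof -
    have ci: "continuous_on {c..1} (\<lambda>h::real. sqrt (1 - h\<^sup>2) ^ n)"
      by (intro continuous_intros)
    have "((\<lambda>h. ?K * sqrt (1 - h\<^sup>2) ^ n) has_integral ?K * integral {c..1} (\<lambda>h. sqrt (1 - h\<^sup>2) ^ n)) {c..1}"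
      using integrable_continuous_real[OF ci] by (intro has_integral_mult_right integrable_integral)
    moreover have "0 \<le> ?K * sqrt (1 - h\<^sup>2) ^ n" if "h \<in> {c..1}" for h
    proof -
      have "h\<^sup>2 \<le> 1" using that c by (auto simp: abs_square_le_1)
      then show ?thesis using K by simp
    qed
    ultimately show ?thesis
      by (rule nn_integral_has_integral_lebesgue'[rotated])
  qed
  finally have "emeasure lborel ?C = ennreal (?K * (sin \<phi> ^ n * cos \<phi> / real (n + 1)))
     + ennreal (?K * integral {c..1} (\<lambda>h. sqrt (1 - h\<^sup>2) ^ n))" .
  moreover have i0: "0 \<le> integral {c..1} (\<lambda>h. sqrt (1 - h\<^sup>2) ^ n)"
    by (intro integral_nonneg integrable_continuous_real continuous_intros)
       (use c in \<open>auto simp: abs_square_le_1 intro!: zero_le_power\<close>)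
  ultimately have "emeasure lborel ?C = ennreal (cap_volume n \<phi>)"
    using K cs by (simp add: cap_volume_def c_def algebra_simps flip: ennreal_plus)
  moreover have "cap_volume n \<phi> \<ge> 0" using K cs i0 by (simp add: cap_volume_def c_def)
  ultimately show ?thesis by (simp add: measure_def)
qed

section \<open>Growth of the cap volume with the angle\<close>

text \<open>
  Derivatives of cap volumes are computed inside an interval, whereas the known value, at angle \<open>0\<close>, belongs to
  its end point; this form of monotonicity connects the two.
\<close>

lemma deriv_nonneg_imp_mono_interior:
  fixes f :: "real \<Rightarrow> real"
  assumes "a \<le> b" "continuous_on {a..b} f"
    and "\<And>x. a < x \<Longrightarrow> x < b \<Longrightarrow> (f has_real_derivative f' x) (at x)"
    and "\<And>x. a < x \<Longrightarrow> x < b \<Longrightarrow> f' x \<ge> 0"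
  shows "f a \<le> f b"
proof (cases "a < b")
  case True
  obtain l z where z: "a < z" "z < b" "(f has_real_derivative l) (at z)" "f b - f a = (b - a) * l"
    using MVT[OF True assms(2)] assms(3) real_differentiable_def by blast
  have "l = f' z" using z assms(3) DERIV_unique by blast
  then show ?thesis using z assms(4)[of z] True
    by (metis diff_ge_0_iff_ge less_imp_le mult_nonneg_nonneg)
qed (use assms in auto)

lemma x_cos_le_sin:
  fixes x :: real
  assumes "0 \<le> x" "x \<le> pi"
  shows "x * cos x \<le> sin x"
proof -
  have "sin 0 - 0 * cos 0 \<le> sin x - x * cos x"
  proof (rule deriv_nonneg_imp_mono_interior[where f = "\<lambda>x. sin x - x * cos x" and f' = "\<lambda>x. x * sin x"])
    fix y :: real assume "0 < y" "y < x"
    then show "0 \<le> y * sin y" using assms by (intro mult_nonneg_nonneg sin_ge_zero) auto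
  qed (use assms in \<open>auto intro!: derivative_eq_intros continuous_intros\<close>)
  then show ?thesis by simp
qed

lemma has_real_derivative_sin_power:
  "((\<lambda>x. sin x ^ Suc m) has_real_derivative (real m + 1) * sin x ^ m * cos x) (at x)"
  using DERIV_power_Suc[OF DERIV_sin[of x], of m] by (simp add: algebra_simps)

lemma continuous_on_cap_volume: "continuous_on {0..pi/2} (cap_volume n)"
proof -
  have "continuous_on {0..1} (\<lambda>c. integral {c..1} (\<lambda>h::real. sqrt (1 - h\<^sup>2) ^ n))"
    by (intro indefinite_integral_continuous_1' integrable_continuous_real continuous_intros)
  then have "continuous_on {0..pi/2} (\<lambda>\<phi>. integral {cos \<phi>..1} (\<lambda>h::real. sqrt (1 - h\<^sup>2) ^ n))"
    by (rule continuous_on_compose2) (auto intro!: continuous_intros cos_ge_zero)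
  then show ?thesis unfolding cap_volume_def by (intro continuous_intros) auto
qed

lemma cap_volume_0: "n \<ge> 1 \<Longrightarrow> cap_volume n 0 = 0"
  by (simp add: cap_volume_def)

text \<open>
  Up to a factor, \<open>cap_volume n\<close> is the integral of \<open>sin ^ (n - 1)\<close>: the boundary terms that arise from
  the two parts of the solid cone combine to a multiple of \<open>sin \<phi> ^ (n - 1)\<close>. The integrand of the second
  part, taken at \<open>cos \<phi>\<close>, is \<open>sin \<phi> ^ n\<close>.
\<close>

lemma has_real_derivative_cap_volume:
  assumes "n \<ge> 1" "0 < \<phi>" "\<phi> < pi / 2"
  shows "(cap_volume n has_real_derivative
     unit_ball_vol (real n) * real n / real (n + 1) * sin \<phi> ^ (n - 1)) (at \<phi>)"
proof -
  define f where "f = (\<lambda>h::real. sqrt (1 - h\<^sup>2) ^ n)"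
  define H where "H = (\<lambda>c. integral {0..c} f)"
  have cf: "continuous_on A f" for A
    unfolding f_def by (intro continuous_intros)
  have cos01: "0 < cos \<phi>" "cos \<phi> < 1" if "0 < \<phi>" "\<phi> < pi / 2" for \<phi>
    using that cos_gt_zero[of \<phi>] cos_monotone_0_pi[of 0 \<phi>] by auto
  have spos: "sin \<phi> > 0" using assms by (intro sin_gt_zero) auto
  have H: "(H has_real_derivative f c) (at c)" if "0 < c" "c < 1" for c
    using integral_has_real_derivative[OF cf, of c 0 1] that
    by (simp add: H_def at_within_Icc_at)
  have eq: "cap_volume n \<psi> = unit_ball_vol (real n) *
     (sin \<psi> ^ n * cos \<psi> / real (n + 1) + (H 1 - H (cos \<psi>)))" if "\<psi> \<in> {0<..<pi/2}" for \<psi>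
  proof -
    have "H (cos \<psi>) + integral {cos \<psi>..1} f = H 1"
      unfolding H_def using cos01[of \<psi>] that cf
      by (intro Henstock_Kurzweil_Integration.integral_combine integrable_continuous_real) auto
    then show ?thesis by (simp add: cap_volume_def f_def)
  qed
  define m where "m = n - 1"
  have n: "n = Suc m" using assms by (simp add: m_def)
  have fc: "f (cos \<phi>) = sin \<phi> ^ n" using spos by (simp add: f_def flip: sin_squared_eq)
  have "((\<lambda>\<psi>. unit_ball_vol (real n) *
     (sin \<psi> ^ n * cos \<psi> / real (n + 1) + (H 1 - H (cos \<psi>)))) has_real_derivative
     unit_ball_vol (real n) * ((real n * sin \<phi> ^ m * cos \<phi> * cos \<phi> - sin \<phi> ^ n * sin \<phi>) / real (n + 1)
       + f (cos \<phi>) * sin \<phi>)) (at \<phi>)"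
  proof -
    have "((\<lambda>\<psi>. H (cos \<psi>)) has_real_derivative f (cos \<phi>) * - sin \<phi>) (at \<phi>)"
      using cos01[of \<phi>] assms by (intro DERIV_chain2[OF H] DERIV_cos) auto
    from DERIV_cmult[OF DERIV_add[OF DERIV_cdivide[OF DERIV_mult[OF has_real_derivative_sin_power[of m]
      DERIV_cos]] DERIV_diff[OF DERIV_const this]]]
    show ?thesis unfolding n by (rule DERIV_cong) (simp add: algebra_simps)
  qed
  also have "(real n * sin \<phi> ^ m * cos \<phi> * cos \<phi> - sin \<phi> ^ n * sin \<phi>) / real (n + 1) + f (cos \<phi>) * sin \<phi>
     = sin \<phi> ^ m * (real n * (cos \<phi>)\<^sup>2 - (sin \<phi>)\<^sup>2 + real (n + 1) * (sin \<phi>)\<^sup>2) / real (n + 1)"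
    unfolding fc n by (simp add: field_simps power2_eq_square)
  also have "(real n * (cos \<phi>)\<^sup>2 - (sin \<phi>)\<^sup>2 + real (n + 1) * (sin \<phi>)\<^sup>2) = real n"
    by (simp add: cos_squared_eq algebra_simps)
  finally have "((\<lambda>\<psi>. unit_ball_vol (real n) *
     (sin \<psi> ^ n * cos \<psi> / real (n + 1) + (H 1 - H (cos \<psi>)))) has_real_derivative
     unit_ball_vol (real n) * real n / real (n + 1) * sin \<phi> ^ (n - 1)) (at \<phi>)"
    by (simp add: m_def mult_ac)
  then show ?thesis
    by (rule has_field_derivative_transform_within_open[where S = "{0<..<pi/2}"])
       (use assms eq in auto)
qed

lemma cap_volume_pos:
  assumes "n \<ge> 1" "0 < \<phi>" "\<phi> < pi / 2"
  shows "cap_volume n \<phi> > 0"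
proof -
  have "cap_volume n 0 < cap_volume n \<phi>"
  proof (rule DERIV_pos_imp_increasing_open[OF assms(2)])
    fix x assume x: "0 < x" "x < \<phi>"
    then have "sin x > 0" using assms by (intro sin_gt_zero) auto
    with has_real_derivative_cap_volume[of n x] x assms unit_ball_vol_pos[of "real n", OF of_nat_0_le_iff]
    show "\<exists>y. (cap_volume n has_real_derivative y) (at x) \<and> 0 < y"
      by (intro exI[of _ "unit_ball_vol (real n) * real n / real (n + 1) * sin x ^ (n - 1)"]) auto
  qed (rule continuous_on_subset[OF continuous_on_cap_volume], use assms in auto)
  then show ?thesis using cap_volume_0 assms by simp
qed

text \<open>
  The logarithmic derivative of the volume is at most \<open>n / \<phi>\<close>. This is the inequality \<open>key\<close> below, which
  follows by integration from \<open>x * cos x \<le> sin x\<close>.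
\<close>

lemma cap_volume_ratio_angle:
  assumes n: "n \<ge> 2" and "0 < \<psi>" "\<psi> \<le> \<phi>" "\<phi> < pi / 2"
  shows "cap_volume n \<phi> / \<phi> ^ n \<le> cap_volume n \<psi> / \<psi> ^ n"
proof -
  define k where "k = unit_ball_vol (real n) * real n / real (n + 1)"
  have k: "k \<ge> 0" using unit_ball_vol_pos[of "real n", OF of_nat_0_le_iff] by (simp add: k_def)
  define m where "m = n - 2"
  have nm: "n = Suc (Suc m)" using n by (simp add: m_def)
  have D: "(cap_volume n has_real_derivative k * sin x ^ Suc m) (at x)" if "0 < x" "x < pi / 2" for x
    using has_real_derivative_cap_volume[of n x] that nm by (simp add: k_def)
  have key: "k * x * sin x ^ Suc m \<le> real n * cap_volume n x" if x: "0 < x" "x < pi / 2" for x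
  proof -
    have "real n * cap_volume n 0 - k * 0 * sin 0 ^ Suc m \<le> real n * cap_volume n x - k * x * sin x ^ Suc m"
    proof (rule deriv_nonneg_imp_mono_interior[where f = "\<lambda>x. real n * cap_volume n x - k * x * sin x ^ Suc m"
          and f' = "\<lambda>x. k * (real m + 1) * sin x ^ m * (sin x - x * cos x)"])
      fix y assume y: "0 < y" "y < x"
      show "((\<lambda>x. real n * cap_volume n x - k * x * sin x ^ Suc m) has_real_derivative
        k * (real m + 1) * sin y ^ m * (sin y - y * cos y)) (at y)"
        using x y by (intro DERIV_cong[OF DERIV_diff[OF DERIV_cmult[OF D]
          DERIV_mult[OF DERIV_cmult[OF DERIV_ident] has_real_derivative_sin_power]]])
          (auto simp: nm algebra_simps)
      show "0 \<le> k * (real m + 1) * sin y ^ m * (sin y - y * cos y)"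
        using x y k x_cos_le_sin[of y]
        by (intro mult_nonneg_nonneg zero_le_power sin_ge_zero) auto
    qed (use x in \<open>auto intro!: continuous_intros continuous_on_subset[OF continuous_on_cap_volume]\<close>)
    then show ?thesis using cap_volume_0 n by simp
  qed
  have "- (cap_volume n \<psi> / \<psi> ^ n) \<le> - (cap_volume n \<phi> / \<phi> ^ n)"
  proof (rule DERIV_nonneg_imp_nondecreasing[OF \<open>\<psi> \<le> \<phi>\<close>])
    fix x assume "\<psi> \<le> x" "x \<le> \<phi>"
    then have x: "0 < x" "x < pi / 2" using assms by auto
    have "((\<lambda>x. - (cap_volume n x / x ^ n)) has_real_derivative
      - ((k * sin x ^ Suc m * x ^ n - cap_volume n x * (real n * x ^ Suc m)) / (x ^ n * x ^ n))) (at x)"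
      using x by (intro DERIV_minus DERIV_divide D)
       (use DERIV_pow[of n x] in \<open>auto simp: nm\<close>)
    also have "- ((k * sin x ^ Suc m * x ^ n - cap_volume n x * (real n * x ^ Suc m)) / (x ^ n * x ^ n))
      = (x ^ Suc m * (real n * cap_volume n x - k * x * sin x ^ Suc m)) / (x ^ n * x ^ n)"
      by (simp add: nm algebra_simps minus_divide_left del: minus_divide_left [symmetric])
    finally show "\<exists>y. ((\<lambda>x. - (cap_volume n x / x ^ n)) has_real_derivative y) (at x) \<and> 0 \<le> y"
      using key[OF x] x by (auto intro!: exI)
  qed
  then show ?thesis by simp
qed

text \<open>
  The logarithmic derivative of the volume is at least \<open>n * cos \<phi> / sin \<phi>\<close>.
\<close>

lemma cap_volume_ratio_sin:
  assumes n: "n \<ge> 1" and "0 < \<psi>" "\<psi> \<le> \<phi>" "\<phi> < pi / 2"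
  shows "cap_volume n \<psi> / sin \<psi> ^ n \<le> cap_volume n \<phi> / sin \<phi> ^ n"
proof -
  define k where "k = unit_ball_vol (real n) * real n / real (n + 1)"
  define m where "m = n - 1"
  have nm: "n = Suc m" using n by (simp add: m_def)
  have D: "(cap_volume n has_real_derivative k * sin x ^ m) (at x)" if "0 < x" "x < pi / 2" for x
    using has_real_derivative_cap_volume[of n x] that nm by (simp add: k_def)
  have key: "real n * cap_volume n x * cos x \<le> k * sin x ^ n" if x: "0 < x" "x < pi / 2" for x
  proof -
    have "k * sin 0 ^ n - real n * cap_volume n 0 * cos 0 \<le> k * sin x ^ n - real n * cap_volume n x * cos x"
    proof (rule deriv_nonneg_imp_mono_interior[where f = "\<lambda>x. k * sin x ^ n - real n * cap_volume n x * cos x"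
          and f' = "\<lambda>x. real n * cap_volume n x * sin x"])
      fix y assume y: "0 < y" "y < x"
      show "((\<lambda>x. k * sin x ^ n - real n * cap_volume n x * cos x) has_real_derivative
        real n * cap_volume n y * sin y) (at y)"
        using x y unfolding nm by (intro DERIV_cong[OF DERIV_diff[OF DERIV_cmult[OF
          has_real_derivative_sin_power] DERIV_mult[OF DERIV_cmult[OF D[unfolded nm]] DERIV_cos]]])
          (auto simp: algebra_simps)
      show "0 \<le> real n * cap_volume n y * sin y"
        using x y cap_volume_pos[OF n, of y]
        by (intro mult_nonneg_nonneg zero_le_power sin_ge_zero) auto
    qed (use x in \<open>auto intro!: continuous_intros continuous_on_subset[OF continuous_on_cap_volume]\<close>)
    then show ?thesis using cap_volume_0[OF n] n by (simp add: power_0_left)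
  qed
  show ?thesis
  proof (rule DERIV_nonneg_imp_nondecreasing[OF \<open>\<psi> \<le> \<phi>\<close>])
    fix x assume "\<psi> \<le> x" "x \<le> \<phi>"
    then have x: "0 < x" "x < pi / 2" using assms by auto
    then have s: "sin x > 0" by (intro sin_gt_zero) auto
    have "((\<lambda>x. cap_volume n x / sin x ^ n) has_real_derivative
      ((k * sin x ^ m * sin x ^ n - cap_volume n x * (real n * sin x ^ m * cos x)) / (sin x ^ n * sin x ^ n))) (at x)"
      using x s unfolding nm by (intro DERIV_divide D[unfolded nm]
        DERIV_cong[OF has_real_derivative_sin_power]) auto
    also have "(k * sin x ^ m * sin x ^ n - cap_volume n x * (real n * sin x ^ m * cos x)) / (sin x ^ n * sin x ^ n)
      = (sin x ^ m * (k * sin x ^ n - real n * cap_volume n x * cos x)) / (sin x ^ n * sin x ^ n)"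
      by (simp add: nm algebra_simps)
    finally show "\<exists>y. ((\<lambda>x. cap_volume n x / sin x ^ n) has_real_derivative y) (at x) \<and> 0 \<le> y"
      using key[OF x] s by (auto intro!: exI)
  qed
qed

section \<open>Caps and the uniform distribution on the sphere\<close>

text \<open>
  The triangle inequality for angles on the unit sphere. Splitting \<open>x\<close> and \<open>z\<close> into their components along \<open>y\<close> and
  orthogonal to \<open>y\<close>, it reduces to the Cauchy-Schwarz inequality for the orthogonal components.
\<close>

lemma cos_angle_triangle:
  fixes x y z :: "'a::real_inner"
  assumes n: "norm x = 1" "norm y = 1" "norm z = 1"
    and ab: "0 \<le> \<alpha>" "0 \<le> \<beta>" "\<alpha> + \<beta> \<le> pi" and xy: "cos \<alpha> \<le> x \<bullet> y" and yz: "cos \<beta> \<le> y \<bullet> z"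
  shows "cos (\<alpha> + \<beta>) \<le> x \<bullet> z"
proof -
  have range: "\<bar>u \<bullet> v\<bar> \<le> 1" if "norm u = 1" "norm v = 1" for u v :: 'a
    using Cauchy_Schwarz_ineq2[of u v] that by simp
  define a where "a = arccos (x \<bullet> y)"
  define b where "b = arccos (y \<bullet> z)"
  have r: "\<bar>x \<bullet> y\<bar> \<le> 1" "\<bar>y \<bullet> z\<bar> \<le> 1" using range n by auto
  have ca: "cos a = x \<bullet> y" "0 \<le> a" "a \<le> pi" and cb: "cos b = y \<bullet> z" "0 \<le> b" "b \<le> pi"
    using r by (auto simp: a_def b_def intro!: cos_arccos_abs arccos_lbound arccos_ubound)
  have "a \<le> \<alpha>" using xy ab ca cos_mono_le_eq[of \<alpha> a] by (simp add: ca(1))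
  have "b \<le> \<beta>" using yz ab cb cos_mono_le_eq[of \<beta> b] by (simp add: cb(1))
  define p where "p = x - (x \<bullet> y) *\<^sub>R y"
  define q where "q = z - (y \<bullet> z) *\<^sub>R y"
  have u: "x \<bullet> x = 1" "y \<bullet> y = 1" "z \<bullet> z = 1" using n by (auto simp: norm_eq_1)
  have "(norm p)\<^sup>2 = (sin a)\<^sup>2" "(norm q)\<^sup>2 = (sin b)\<^sup>2"
    unfolding power2_norm_eq_inner sin_squared_eq ca cb p_def q_def
    using u by (simp_all add: inner_diff inner_commute power2_eq_square)
  then have pq: "norm p = sin a" "norm q = sin b"
    using ca cb by (simp_all add: sin_ge_zero)
  have "x \<bullet> z = (x \<bullet> y) * (y \<bullet> z) + p \<bullet> q"
    using u by (simp add: p_def q_def inner_diff inner_commute)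
  moreover have "p \<bullet> q \<ge> - (norm p * norm q)"
    using Cauchy_Schwarz_ineq2[of p q] by simp
  ultimately have "x \<bullet> z \<ge> cos (a + b)"
    by (simp add: cos_add ca cb pq)
  moreover have "cos (\<alpha> + \<beta>) \<le> cos (a + b)"
    using \<open>a \<le> \<alpha>\<close> \<open>b \<le> \<beta>\<close> ab ca cb by (intro cos_monotone_0_pi_le) auto
  ultimately show ?thesis by simp
qed

text \<open>
  The direction of a random point of the ball. The value of \<open>sgn\<close> at \<open>0\<close> makes
  \<open>0\<close> a possible outcome, of probability zero.
\<close>

definition sphere_uniform :: "'a::euclidean_space measure" where
  "sphere_uniform = distr (uniform_measure lborel (cball 0 1)) borel sgn"

definition cap :: "'a::euclidean_space \<Rightarrow> real \<Rightarrow> 'a set" where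
  "cap y \<phi> = {x \<in> sphere 0 1. cos \<phi> \<le> x \<bullet> y}"

text \<open>
  The fraction of the unit sphere that a cap of angular radius \<open>\<phi>\<close> occupies (\<open>measure_cap\<close>). The type
  argument fixes the ambient space.
\<close>

definition cap_fraction :: "'a::euclidean_space itself \<Rightarrow> real \<Rightarrow> real" where
  "cap_fraction T \<phi> = cap_volume (DIM('a) - 1) \<phi> / measure lborel (cball (0::'a) 1)"

lemma sets_sphere_uniform [measurable_cong, simp]: "sets sphere_uniform = sets borel"
  and space_sphere_uniform [simp]: "space sphere_uniform = UNIV"
  by (simp_all add: sphere_uniform_def)

lemma unit_ball_emeasure: "emeasure lborel (cball (0::'a::euclidean_space) 1) \<noteq> 0"
    "emeasure lborel (cball (0::'a) 1) \<noteq> \<infinity>"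
  using unit_ball_vol_pos[of "real DIM('a)", OF of_nat_0_le_iff] by (simp_all add: emeasure_cball del: unit_ball_vol_pos)

interpretation sphere_uniform: prob_space "sphere_uniform :: 'a::euclidean_space measure"
proof -
  interpret prob_space "uniform_measure lborel (cball (0::'a) 1)"
    by (rule prob_space_uniform_measure) (fact unit_ball_emeasure)+
  show "prob_space (sphere_uniform :: 'a measure)"
    unfolding sphere_uniform_def by (rule prob_space_distr) simp
qed

lemma measure_sphere_uniform:
  fixes A :: "'a::euclidean_space set"
  assumes A[measurable]: "A \<in> sets borel"
  shows "measure sphere_uniform A = measure lborel {p \<in> cball 0 1. sgn p \<in> A} / measure lborel (cball (0::'a) 1)"
proof -
  have m: "sgn -` A \<in> sets borel" using measurable_sets[OF borel_measurable_sgn A] by simp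
  have "measure sphere_uniform A = measure (uniform_measure lborel (cball 0 1)) (sgn -` A)"
    unfolding sphere_uniform_def by (subst measure_distr) auto
  also have "\<dots> = measure lborel (cball 0 1 \<inter> sgn -` A) / measure lborel (cball (0::'a) 1)"
    using m by (intro measure_uniform_measure unit_ball_emeasure) simp
  also have "cball 0 1 \<inter> sgn -` A = {p \<in> cball 0 1. sgn p \<in> A}" by auto
  finally show ?thesis .
qed

lemma AE_sphere_uniform: "AE x in sphere_uniform. x \<in> sphere (0::'a::euclidean_space) 1"
proof -
  have "AE x in lborel. x \<noteq> (0::'a)"
    by (rule AE_lborel_singleton)
  then have "AE x in uniform_measure lborel (cball 0 1). x \<noteq> (0::'a)"
    by (intro AE_uniform_measureI) auto
  then have "AE x in uniform_measure lborel (cball 0 1). sgn x \<in> sphere (0::'a) 1"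
    by eventually_elim (simp add: norm_sgn)
  then show ?thesis unfolding sphere_uniform_def by (subst AE_distr_iff) auto
qed

lemma borel_cap [measurable]: "cap y \<phi> \<in> sets borel"
proof -
  have "closed (cap y \<phi>)"
    unfolding cap_def sphere_def mem_Collect_eq
    by (intro closed_Collect_conj closed_Collect_le closed_Collect_eq continuous_intros)
  then show ?thesis by simp
qed

text \<open>
  A reflection exchanges the two axes, so volumes have to be computed for coordinate axes only.
\<close>

lemma measure_solid_cone_rotate:
  fixes x y :: "'a::euclidean_space"
  assumes "norm x = norm y"
  shows "measure lborel {p \<in> cball 0 1. c * norm p \<le> p \<bullet> x} = measure lborel {p \<in> cball 0 1. c * norm p \<le> p \<bullet> y}"
    (is "measure lborel (?C x) = measure lborel (?C y)")
proof -
  obtain f where f: "orthogonal_transformation f" "f x = y" "f \<circ> f = id"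
    using reflection_exists[OF assms] .
  have [measurable]: "f \<in> borel_measurable borel"
    using f by (intro borel_measurable_continuous_onI) (simp add: linear_continuous_on linear_linear orthogonal_transformation_linear)
  have *: "f p \<bullet> y = p \<bullet> x" for p
    using f by (metis orthogonal_transformation_def)
  have [measurable]: "?C z \<in> sets borel" for z by measurable
  have "measure lborel (?C y) = measure (distr lborel borel f) (?C y)"
    by (simp add: distr_lborel_orthogonal_transformation[OF f(1)])
  also have "\<dots> = measure lborel (f -` ?C y)" by (subst measure_distr) auto
  also have "f -` ?C y = ?C x"
    using f(1) by (auto simp: * orthogonal_transformation_norm)
  finally show ?thesis by simp
qed

lemma measure_cap:
  fixes y :: "'a::euclidean_space"
  assumes dim: "DIM('a) \<ge> 2" and y: "norm y = 1" and phi: "0 < \<phi>" "\<phi> < pi / 2"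
  shows "measure sphere_uniform (cap y \<phi>) = cap_fraction TYPE('a) \<phi>"
proof -
  have "measure lborel {p \<in> cball 0 1. sgn p \<in> cap y \<phi>} = measure lborel {p \<in> cball 0 1. cos \<phi> * norm p \<le> p \<bullet> y}"
  proof (rule measure_eq_AE)
    have "AE p in lborel. p \<noteq> (0::'a)"
      by (rule AE_lborel_singleton)
    then show "AE p in lborel. p \<in> {p \<in> cball 0 1. sgn p \<in> cap y \<phi>} \<longleftrightarrow> p \<in> {p \<in> cball 0 1. cos \<phi> * norm p \<le> p \<bullet> y}"
      by eventually_elim (auto simp: cap_def norm_sgn sgn_div_norm field_simps)
  qed measurable
  also obtain b :: 'a where b: "b \<in> Basis" using nonempty_Basis by blast
  have "measure lborel {p \<in> cball 0 1. cos \<phi> * norm p \<le> p \<bullet> y} = measure lborel {p \<in> cball 0 1. cos \<phi> * norm p \<le> p \<bullet> b}"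
    using y b by (intro measure_solid_cone_rotate) auto
  also have "\<dots> = cap_volume (DIM('a) - 1) \<phi>"
    using b phi dim by (intro measure_solid_cone) auto
  finally show ?thesis by (simp add: measure_sphere_uniform cap_fraction_def)
qed

text \<open>
  Almost all mass lies on the sphere, so caps may be replaced by half-spaces. This turns expressions
  such as the probability that \<open>x\<close> covers \<open>u\<close> into measures of simple sets.
\<close>

lemma measure_halfspace:
  fixes y :: "'a::euclidean_space"
  assumes dim: "DIM('a) \<ge> 2" and y: "norm y = 1" and phi: "0 < \<phi>" "\<phi> < pi / 2"
  shows "measure sphere_uniform {x. cos \<phi> \<le> x \<bullet> y} = cap_fraction TYPE('a) \<phi>"
proof -
  have "measure sphere_uniform {x. cos \<phi> \<le> x \<bullet> y} = measure sphere_uniform (cap y \<phi>)"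
    by (rule measure_eq_AE) (use AE_sphere_uniform in \<open>auto simp: cap_def\<close>)
  then show ?thesis using measure_cap[OF assms] by simp
qed

lemma cap_fraction_pos:
  assumes "DIM('a::euclidean_space) \<ge> 2" "0 < \<phi>" "\<phi> < pi / 2"
  shows "cap_fraction TYPE('a) \<phi> > 0"
  using cap_volume_pos[of "DIM('a) - 1" \<phi>] assms unit_ball_vol_pos[of "real DIM('a)", OF of_nat_0_le_iff]
  by (simp add: cap_fraction_def content_cball)

lemma cap_fraction_le_1:
  assumes "DIM('a::euclidean_space) \<ge> 2" "0 < \<phi>" "\<phi> < pi / 2"
  shows "cap_fraction TYPE('a) \<phi> \<le> 1"
proof -
  obtain b :: 'a where "b \<in> Basis" using nonempty_Basis by blast
  then have "norm b = 1" by simp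
  from measure_cap[OF assms(1) this assms(2,3)] show ?thesis
    using sphere_uniform.prob_le_1[of "cap b \<phi>"] by simp
qed

text \<open>
  Caps grow at most as fast as Euclidean balls with the same radii.
\<close>

lemma cap_fraction_ratio_angle:
  assumes dim: "DIM('a::euclidean_space) = n + 1" "n \<ge> 2" and "0 < \<psi>" "\<psi> \<le> \<phi>" "\<phi> < pi / 2"
  shows "cap_fraction TYPE('a) \<phi> \<le> (\<phi> / \<psi>) ^ n * cap_fraction TYPE('a) \<psi>"
proof -
  have "cap_volume n \<phi> \<le> (\<phi> / \<psi>) ^ n * cap_volume n \<psi>"
    using cap_volume_ratio_angle[of n \<psi> \<phi>] assms by (simp add: power_divide field_simps)
  then have "cap_volume n \<phi> / measure lborel (cball (0::'a) 1)
      \<le> ((\<phi> / \<psi>) ^ n * cap_volume n \<psi>) / measure lborel (cball (0::'a) 1)"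
    by (intro divide_right_mono) auto
  then show ?thesis using dim by (simp add: cap_fraction_def)
qed

text \<open>
  Caps grow at least as fast as Euclidean balls whose radii are the sines of the angles.
\<close>

lemma cap_fraction_ratio_sin:
  assumes dim: "DIM('a::euclidean_space) = n + 1" "n \<ge> 1" and "0 < \<psi>" "\<psi> \<le> \<phi>" "\<phi> < pi / 2"
  shows "cap_fraction TYPE('a) \<psi> \<le> (sin \<psi> / sin \<phi>) ^ n * cap_fraction TYPE('a) \<phi>"
proof -
  have "sin \<psi> > 0" "sin \<phi> > 0" using assms by (auto intro!: sin_gt_zero)
  then have "cap_volume n \<psi> \<le> (sin \<psi> / sin \<phi>) ^ n * cap_volume n \<phi>"
    using cap_volume_ratio_sin[of n \<psi> \<phi>] assms by (simp add: power_divide field_simps)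
  then have "cap_volume n \<psi> / measure lborel (cball (0::'a) 1)
      \<le> ((sin \<psi> / sin \<phi>) ^ n * cap_volume n \<phi>) / measure lborel (cball (0::'a) 1)"
    by (intro divide_right_mono) auto
  then show ?thesis using dim by (simp add: cap_fraction_def)
qed

lemma cap_fraction_mono:
  assumes "DIM('a::euclidean_space) \<ge> 2" "0 < \<psi>" "\<psi> \<le> \<phi>" "\<phi> < pi / 2"
  shows "cap_fraction TYPE('a) \<psi> \<le> cap_fraction TYPE('a) \<phi>"
proof -
  define n where "n = DIM('a) - 1"
  have s: "sin \<psi> > 0" "sin \<phi> > 0" using assms by (auto intro!: sin_gt_zero)
  have "sin \<psi> \<le> sin \<phi>" using assms by (intro sin_monotone_2pi_le) auto
  then have "(sin \<psi> / sin \<phi>) ^ n \<le> 1" using s by (intro power_le_one) auto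
  moreover have le: "cap_fraction TYPE('a) \<psi> \<le> (sin \<psi> / sin \<phi>) ^ n * cap_fraction TYPE('a) \<phi>"
    using assms by (intro cap_fraction_ratio_sin) (auto simp: n_def)
  moreover have "cap_fraction TYPE('a) \<phi> > 0" using assms by (intro cap_fraction_pos) auto
  ultimately have "(sin \<psi> / sin \<phi>) ^ n * cap_fraction TYPE('a) \<phi> \<le> 1 * cap_fraction TYPE('a) \<phi>"
    by (intro mult_right_mono) auto
  then show ?thesis using le by simp
qed

text \<open>
  The caps of radius \<open>\<alpha> / 2\<close> around \<open>\<alpha>\<close>-separated points are disjoint, so the measure of \<open>U\<close> bounds the
  number of points. Hence a separated set with the largest number of points exists, and by
  maximality every point of \<open>A\<close> is within \<open>\<alpha>\<close> of it.
\<close>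

lemma maximal_separated_set:
  fixes A U :: "'a::euclidean_space set"
  assumes dim: "DIM('a) \<ge> 2" and \<alpha>: "0 < \<alpha>" "\<alpha> < pi"
    and A: "A \<subseteq> sphere 0 1" and U: "U \<in> sets borel" "\<And>a. a \<in> A \<Longrightarrow> cap a (\<alpha> / 2) \<subseteq> U"
  obtains W where "W \<subseteq> A" "finite W" "\<And>a. a \<in> A \<Longrightarrow> \<exists>w\<in>W. cos \<alpha> \<le> a \<bullet> w"
    "real (card W) * cap_fraction TYPE('a) (\<alpha> / 2) \<le> measure sphere_uniform U"
proof -
  define V where "V = cap_fraction TYPE('a) (\<alpha> / 2)"
  have V: "V > 0" unfolding V_def using dim \<alpha> by (intro cap_fraction_pos) auto
  define S where "S = (\<lambda>W. finite W \<and> W \<subseteq> A \<and> (\<forall>v\<in>W. \<forall>w\<in>W. v \<noteq> w \<longrightarrow> v \<bullet> w < cos \<alpha>))"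
  have bound: "real (card W) * V \<le> measure sphere_uniform U" if "S W" for W
  proof -
    have W: "finite W" "W \<subseteq> A" and sep: "\<And>v w. v \<in> W \<Longrightarrow> w \<in> W \<Longrightarrow> v \<noteq> w \<Longrightarrow> v \<bullet> w < cos \<alpha>"
      using that by (auto simp: S_def)
    have unit: "norm w = 1" if "w \<in> W" for w using that W A by auto
    have disj: "disjoint_family_on (\<lambda>w. cap w (\<alpha> / 2)) W"
    proof (unfold disjoint_family_on_def, intro ballI impI equals0I)
      fix v w p assume vw: "v \<in> W" "w \<in> W" "v \<noteq> w" "p \<in> cap v (\<alpha> / 2) \<inter> cap w (\<alpha> / 2)"
      then have "cos (\<alpha> / 2 + \<alpha> / 2) \<le> v \<bullet> w"
        using \<alpha> unit by (intro cos_angle_triangle[where y = p]) (auto simp: cap_def inner_commute)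
      then show False using sep[OF vw(1-3)] by simp
    qed
    have "real (card W) * V = (\<Sum>w\<in>W. measure sphere_uniform (cap w (\<alpha> / 2)))"
      using unit dim \<alpha> by (simp add: measure_cap V_def)
    also have "\<dots> = measure sphere_uniform (\<Union>w\<in>W. cap w (\<alpha> / 2))"
      using W disj by (intro sphere_uniform.finite_measure_finite_Union[symmetric]) auto
    also have "\<dots> \<le> measure sphere_uniform U"
      using U W by (intro sphere_uniform.finite_measure_mono) auto
    finally show ?thesis .
  qed
  have card: "card W < Suc (nat \<lfloor>measure sphere_uniform U / V\<rfloor>)" if "S W" for W
    unfolding less_Suc_eq_le using bound[OF that] V by (intro le_nat_floor) (simp add: pos_le_divide_eq)
  have "S {}" by (simp add: S_def)
  then obtain W where W: "S W" "\<And>W'. S W' \<Longrightarrow> card W' \<le> card W"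
    using ex_has_greatest_nat[of S "{}" card] card by metis
  \<comment> \<open>Otherwise \<open>a\<close> could be added to \<open>W\<close>.\<close>
  have "\<exists>w\<in>W. cos \<alpha> \<le> a \<bullet> w" if a: "a \<in> A" for a
  proof (rule ccontr)
    assume far: "\<not> (\<exists>w\<in>W. cos \<alpha> \<le> a \<bullet> w)"
    have "a \<bullet> a = 1" using a A by (auto simp: norm_eq_1)
    then have "a \<notin> W" using far cos_le_one[of \<alpha>] by auto
    have "S (insert a W)" using W(1) a far by (auto simp: S_def inner_commute not_le)
    then have "card (insert a W) \<le> card W" by (rule W(2))
    then show False using \<open>a \<notin> W\<close> W(1) by (simp add: S_def)
  qed
  moreover have "W \<subseteq> A" "finite W" using W(1) by (auto simp: S_def)
  ultimately show ?thesis using that bound[OF W(1)] unfolding V_def by blast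
qed

section \<open>Random centers and covering at one scale\<close>

lemma exists_sphere_point_le_expectation:
  fixes f :: "'a::euclidean_space \<Rightarrow> real"
  assumes "integrable sphere_uniform f" "integral\<^sup>L sphere_uniform f \<le> c"
  obtains x where "x \<in> sphere 0 1" "f x \<le> c"
proof -
  have "\<exists>x\<in>sphere 0 1. f x \<le> c"
  proof (rule ccontr)
    assume "\<not> ?thesis"
    then have "\<forall>x\<in>sphere 0 1. c < f x" by auto
    then have "AE x in sphere_uniform. c < f x"
      using AE_sphere_uniform by (auto elim!: eventually_mono)
    from sphere_uniform.expectation_greater[OF assms(1) this] assms(2) show False by simp
  qed
  then show ?thesis using that by blast
qed

text \<open>
  Over \<open>N\<close> independent random centers, the weighted sum has expectation at most the right-hand side. Fixing the
  centers one by one, each below its average, replaces the product space: the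
  weights \<open>a j\<close> absorb the factors of the centers that are already fixed.
\<close>

lemma exists_points_product_potential:
  fixes f :: "'i \<Rightarrow> 'a::euclidean_space \<Rightarrow> real"
  assumes J: "finite J" and f: "\<And>j. j \<in> J \<Longrightarrow> integrable sphere_uniform (f j)"
      "\<And>j. j \<in> J \<Longrightarrow> integral\<^sup>L sphere_uniform (f j) \<le> c j"
    and nonneg: "\<And>j x. j \<in> J \<Longrightarrow> 0 \<le> f j x" and a: "\<And>j. j \<in> J \<Longrightarrow> 0 \<le> a j"
  obtains xs where "length xs = N" "set xs \<subseteq> sphere 0 1"
    "(\<Sum>j\<in>J. a j * prod_list (map (f j) xs)) \<le> (\<Sum>j\<in>J. a j * c j ^ N)"
proof -
  have c: "0 \<le> c j" if "j \<in> J" for j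
  proof -
    have "0 \<le> integral\<^sup>L sphere_uniform (f j)"
      using nonneg[OF that] by (intro Bochner_Integration.integral_nonneg) auto
    then show ?thesis using f(2)[OF that] by simp
  qed
  have "\<exists>xs. length xs = N \<and> set xs \<subseteq> sphere 0 1 \<and>
      (\<Sum>j\<in>J. a j * prod_list (map (f j) xs)) \<le> (\<Sum>j\<in>J. a j * c j ^ N)"
    using a
  proof (induction N arbitrary: a)
    case 0
    then show ?case by (intro exI[of _ "[]"]) auto
  next
    case (Suc N)
    obtain xs where xs: "length xs = N" "set xs \<subseteq> sphere 0 1"
      "(\<Sum>j\<in>J. (a j * c j) * prod_list (map (f j) xs)) \<le> (\<Sum>j\<in>J. (a j * c j) * c j ^ N)"
      using Suc.IH[of "\<lambda>j. a j * c j"] Suc.prems c by fastforce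
    \<comment> \<open>The weights after all but one of the centers are fixed.\<close>
    define b where "b = (\<lambda>j. a j * prod_list (map (f j) xs))"
    have b: "0 \<le> b j" if "j \<in> J" for j
      unfolding b_def using Suc.prems[OF that] nonneg[OF that]
      by (intro mult_nonneg_nonneg prod_list_nonneg) auto
    have "integrable sphere_uniform (\<lambda>x. \<Sum>j\<in>J. b j * f j x)"
      using f by (intro Bochner_Integration.integrable_sum integrable_mult_right) auto
    moreover have "integral\<^sup>L sphere_uniform (\<lambda>x. \<Sum>j\<in>J. b j * f j x) \<le> (\<Sum>j\<in>J. b j * c j)"
      using f b by (subst Bochner_Integration.integral_sum) (auto intro!: sum_mono mult_left_mono)
    ultimately obtain x where x: "x \<in> sphere 0 1" "(\<Sum>j\<in>J. b j * f j x) \<le> (\<Sum>j\<in>J. b j * c j)"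
      by (rule exists_sphere_point_le_expectation)
    have "(\<Sum>j\<in>J. a j * prod_list (map (f j) (x # xs))) = (\<Sum>j\<in>J. b j * f j x)"
      by (intro sum.cong) (auto simp: b_def)
    also have "\<dots> \<le> (\<Sum>j\<in>J. b j * c j)" by (rule x)
    also have "\<dots> = (\<Sum>j\<in>J. (a j * c j) * prod_list (map (f j) xs))"
      by (intro sum.cong) (auto simp: b_def)
    also have "\<dots> \<le> (\<Sum>j\<in>J. a j * c j ^ Suc N)" using xs(3) by (simp add: mult.assoc)
    finally show ?case using x xs by (intro exI[of _ "x # xs"]) auto
  qed
  then show ?thesis using that by blast
qed

text \<open>
  By symmetry of \<open>u \<bullet> x\<close> and Fubini, a random cap misses each point \<open>u\<close>, and hence on average
  the set \<open>U\<close>, with probability \<open>1 - V \<phi>\<close>.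
\<close>

lemma exists_cap_average_coverage:
  fixes U :: "'a::euclidean_space set"
  assumes dim: "DIM('a) \<ge> 2" and phi: "0 < \<phi>" "\<phi> < pi / 2"
    and U[measurable]: "U \<in> sets borel" and sub: "U \<subseteq> sphere 0 1"
  obtains x where "x \<in> sphere 0 1"
    "measure sphere_uniform {u \<in> U. u \<bullet> x < cos \<phi>} \<le> (1 - cap_fraction TYPE('a) \<phi>) * measure sphere_uniform U"
proof -
  interpret P: pair_sigma_finite "sphere_uniform :: 'a measure" "sphere_uniform :: 'a measure" ..
  define S where "S = {p :: 'a \<times> 'a. snd p \<in> U \<and> snd p \<bullet> fst p < cos \<phi>}"
  have S[measurable]: "S \<in> sets (sphere_uniform \<Otimes>\<^sub>M sphere_uniform)"
  proof -
    have "{p \<in> space (sphere_uniform \<Otimes>\<^sub>M sphere_uniform). snd p \<in> U \<and> snd p \<bullet> fst p < cos \<phi>}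
        \<in> sets (sphere_uniform \<Otimes>\<^sub>M (sphere_uniform :: 'a measure))"
      by measurable
    then show ?thesis by (simp add: S_def space_pair_measure)
  qed
  define g where "g = (\<lambda>x. measure sphere_uniform {u \<in> U. u \<bullet> x < cos \<phi>})"
  have sec: "Pair x -` S = {u \<in> U. u \<bullet> x < cos \<phi>}" for x by (auto simp: S_def)
  have g: "ennreal (g x) = emeasure sphere_uniform (Pair x -` S)" for x
    unfolding sec g_def by (simp add: sphere_uniform.emeasure_eq_measure)
  have mg: "(\<lambda>x. emeasure sphere_uniform (Pair x -` S)) \<in> borel_measurable sphere_uniform"
    using S by (rule sphere_uniform.measurable_emeasure_Pair)
  then have [measurable]: "g \<in> borel_measurable sphere_uniform"
  proof -
    have "g = (\<lambda>x. enn2real (emeasure sphere_uniform (Pair x -` S)))"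
      by (auto simp: g[symmetric] g_def)
    then show ?thesis using mg by simp
  qed
  have int: "integrable sphere_uniform g"
    by (rule sphere_uniform.integrable_const_bound[where B = 1]) (auto simp: g_def)
  have half: "emeasure sphere_uniform {x. u \<bullet> x < cos \<phi>} = ennreal (1 - cap_fraction TYPE('a) \<phi>)" if "u \<in> U" for u
  proof -
    have "norm u = 1" using that sub by auto
    then have m: "measure sphere_uniform {x. cos \<phi> \<le> x \<bullet> u} = cap_fraction TYPE('a) \<phi>"
      using dim phi by (intro measure_halfspace)
    have "measure sphere_uniform (UNIV - {x. cos \<phi> \<le> x \<bullet> u}) = 1 - measure sphere_uniform {x. cos \<phi> \<le> x \<bullet> u}"
      using sphere_uniform.prob_compl[of "{x. cos \<phi> \<le> x \<bullet> u}"] by simp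
    also have "UNIV - {x. cos \<phi> \<le> x \<bullet> u} = {x. u \<bullet> x < cos \<phi>}"
      by (auto simp: inner_commute)
    finally show ?thesis using m by (simp add: sphere_uniform.emeasure_eq_measure)
  qed
  have le1: "cap_fraction TYPE('a) \<phi> \<le> 1" using dim phi by (rule cap_fraction_le_1)
  have "ennreal (integral\<^sup>L sphere_uniform g) = (\<integral>\<^sup>+x. ennreal (g x) \<partial>sphere_uniform)"
    using int by (intro nn_integral_eq_integral[symmetric]) (auto simp: g_def)
  also have "\<dots> = emeasure (sphere_uniform \<Otimes>\<^sub>M sphere_uniform) S"
    unfolding g using S by (rule sphere_uniform.emeasure_pair_measure_alt[symmetric])
  also have "\<dots> = (\<integral>\<^sup>+u. emeasure sphere_uniform ((\<lambda>x. (x, u)) -` S) \<partial>sphere_uniform)"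
    using S by (rule P.emeasure_pair_measure_alt2)
  also have "\<dots> = (\<integral>\<^sup>+u. ennreal (1 - cap_fraction TYPE('a) \<phi>) * indicator U u \<partial>sphere_uniform)"
  proof (intro nn_integral_cong)
    fix u :: 'a
    show "emeasure sphere_uniform ((\<lambda>x. (x, u)) -` S) = ennreal (1 - cap_fraction TYPE('a) \<phi>) * indicator U u"
    proof (cases "u \<in> U")
      case True
      then have "(\<lambda>x. (x, u)) -` S = {x. u \<bullet> x < cos \<phi>}" by (auto simp: S_def)
      then show ?thesis using half[OF True] True by simp
    next
      case False
      then have "(\<lambda>x. (x, u)) -` S = {}" by (auto simp: S_def)
      then show ?thesis using False by simp
    qed
  qed
  also have "\<dots> = ennreal ((1 - cap_fraction TYPE('a) \<phi>) * measure sphere_uniform U)"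
    using le1 by (subst nn_integral_cmult_indicator)
      (auto simp: sphere_uniform.emeasure_eq_measure ennreal_mult')
  finally have "integral\<^sup>L sphere_uniform g \<le> (1 - cap_fraction TYPE('a) \<phi>) * measure sphere_uniform U"
    using le1 by (simp add: ennreal_inj integral_nonneg g_def)
  from exists_sphere_point_le_expectation[OF int this] show ?thesis
    using that by (auto simp: g_def)
qed

lemma exists_caps_small_uncovered:
  assumes dim: "DIM('a::euclidean_space) \<ge> 2" and phi: "0 < \<phi>" "\<phi> < pi / 2"
  obtains X :: "'a::euclidean_space set" where "finite X" "card X \<le> N" "X \<subseteq> sphere 0 1"
    "measure sphere_uniform {u \<in> sphere 0 1. \<forall>x\<in>X. u \<bullet> x < cos \<phi>} \<le> (1 - cap_fraction TYPE('a) \<phi>) ^ N"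
proof -
  have "\<exists>X :: 'a set. finite X \<and> card X \<le> N \<and> X \<subseteq> sphere 0 1 \<and>
    measure sphere_uniform {u \<in> sphere 0 1. \<forall>x\<in>X. u \<bullet> x < cos \<phi>} \<le> (1 - cap_fraction TYPE('a) \<phi>) ^ N"
  proof (induction N)
    case 0
    show ?case by (intro exI[of _ "{}"]) auto
  next
    case (Suc N)
    then obtain X :: "'a set" where X: "finite X" "card X \<le> N" "X \<subseteq> sphere 0 1" and
      small: "measure sphere_uniform {u \<in> sphere 0 1. \<forall>x\<in>X. u \<bullet> x < cos \<phi>} \<le> (1 - cap_fraction TYPE('a) \<phi>) ^ N"
      (is "measure _ ?U \<le> _") by blast
    have "{u::'a. u \<in> sphere 0 1} \<in> sets borel" by (simp add: borel_closed)
    then have U: "?U \<in> sets borel" using X(1) by measurable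
    obtain x where x: "x \<in> sphere 0 1"
      "measure sphere_uniform {u \<in> ?U. u \<bullet> x < cos \<phi>} \<le> (1 - cap_fraction TYPE('a) \<phi>) * measure sphere_uniform ?U"
      by (rule exists_cap_average_coverage[OF dim phi U]) auto
    note x(2)
    also have "(1 - cap_fraction TYPE('a) \<phi>) * measure sphere_uniform ?U \<le> (1 - cap_fraction TYPE('a) \<phi>) ^ Suc N"
      using small cap_fraction_le_1[OF dim phi] by (simp add: mult_left_mono)
    finally have "measure sphere_uniform {u \<in> sphere 0 1. \<forall>x\<in>insert x X. u \<bullet> x < cos \<phi>} \<le> (1 - cap_fraction TYPE('a) \<phi>) ^ Suc N"
      by (simp add: conj_ac)
    then show ?case using X x(1)
      by (intro exI[of _ "insert x X"]) (auto simp: card_insert_if)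
  qed
  then show ?thesis using that by blast
qed

text \<open>
  The random caps have angle \<open>\<phi>\<^sub>0\<close>, but in the covering they have angle \<open>\<phi> \<ge> \<phi>\<^sub>0 + \<eta>\<close>. A point \<open>a\<close> that is still
  uncovered then has a whole cap of angle \<open>\<eta>\<close> outside the caps of angle \<open>\<phi>\<^sub>0\<close>. The additional centers are a maximal
  \<open>2 * \<eta>\<close>-separated set of such points; as \<open>2 * \<eta> \<le> \<phi>\<close>, their caps cover what is left.
\<close>

lemma one_scale_covering:
  assumes dim: "DIM('a::euclidean_space) \<ge> 2" and "0 < \<phi>\<^sub>0" "0 < \<eta>" "\<phi>\<^sub>0 + \<eta> \<le> \<phi>" "2 * \<eta> \<le> \<phi>" "\<phi> < pi / 2"
  obtains X :: "'a::euclidean_space set" where "finite X" "X \<subseteq> sphere 0 1" "\<And>u. u \<in> sphere 0 1 \<Longrightarrow> \<exists>x\<in>X. cos \<phi> \<le> u \<bullet> x"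
    "real (card X) \<le> real N + (1 - cap_fraction TYPE('a) \<phi>\<^sub>0) ^ N / cap_fraction TYPE('a) \<eta>"
proof -
  obtain X :: "'a set" where X: "finite X" "card X \<le> N" "X \<subseteq> sphere 0 1" and
    small: "measure sphere_uniform {u \<in> sphere 0 1. \<forall>x\<in>X. u \<bullet> x < cos \<phi>\<^sub>0} \<le> (1 - cap_fraction TYPE('a) \<phi>\<^sub>0) ^ N"
    (is "measure _ ?U \<le> _")
    using exists_caps_small_uncovered[OF dim, of "\<phi>\<^sub>0" N] assms by auto
  define A where "A = {u \<in> sphere (0::'a) 1. \<forall>x\<in>X. u \<bullet> x < cos \<phi>}"
  have "{u::'a. u \<in> sphere 0 1} \<in> sets borel" by (simp add: borel_closed)
  then have U: "?U \<in> sets borel" using X(1) by measurable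
  have cap: "cap a (2 * \<eta> / 2) \<subseteq> ?U" if a: "a \<in> A" for a
  proof
    fix p assume p: "p \<in> cap a (2 * \<eta> / 2)"
    have "p \<bullet> x < cos \<phi>\<^sub>0" if "x \<in> X" for x
    proof (rule ccontr)
      assume "\<not> p \<bullet> x < cos \<phi>\<^sub>0"
      then have "cos (\<eta> + \<phi>\<^sub>0) \<le> a \<bullet> x"
        using p a that X assms by (intro cos_angle_triangle[where y = p]) (auto simp: cap_def A_def inner_commute)
      moreover have "cos \<phi> \<le> cos (\<eta> + \<phi>\<^sub>0)"
        using assms by (intro cos_monotone_0_pi_le) auto
      ultimately show False using a that by (auto simp: A_def)
    qed
    then show "p \<in> ?U" using p by (auto simp: cap_def)
  qed
  obtain W where W: "W \<subseteq> A" "finite W" "\<And>a. a \<in> A \<Longrightarrow> \<exists>w\<in>W. cos (2 * \<eta>) \<le> a \<bullet> w"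
      "real (card W) * cap_fraction TYPE('a) (2 * \<eta> / 2) \<le> measure sphere_uniform ?U"
    by (rule maximal_separated_set[OF dim, of "2 * \<eta>" A ?U]) (use assms cap U in \<open>auto simp: A_def\<close>)
  have V: "cap_fraction TYPE('a) \<eta> > 0" using assms by (intro cap_fraction_pos) auto
  show ?thesis
  proof (rule that[of "X \<union> W"])
    fix u :: 'a assume u: "u \<in> sphere 0 1"
    show "\<exists>x\<in>X \<union> W. cos \<phi> \<le> u \<bullet> x"
    proof (cases "u \<in> A")
      case True
      moreover have "cos \<phi> \<le> cos (2 * \<eta>)" using assms by (intro cos_monotone_0_pi_le) auto
      ultimately show ?thesis using W(3)[OF True] by force
    qed (use u in \<open>auto simp: A_def not_less\<close>)
  next
    have "real (card W) \<le> (1 - cap_fraction TYPE('a) \<phi>\<^sub>0) ^ N / cap_fraction TYPE('a) \<eta>"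
      using W(4) small V by (simp add: pos_le_divide_eq)
    moreover have "card (X \<union> W) \<le> card X + card W" by (rule card_Un_le)
    ultimately show "real (card (X \<union> W)) \<le> real N + (1 - cap_fraction TYPE('a) \<phi>\<^sub>0) ^ N / cap_fraction TYPE('a) \<eta>"
      using X(2) by linarith
  qed (use X W in \<open>auto simp: A_def\<close>)
qed

section \<open>Covering at two scales\<close>

text \<open>
  A center \<open>x\<close> within \<open>\<phi>'\<close> of \<open>y\<close> fails to cover \<open>z\<close> only if its component along \<open>w\<close>, the direction from \<open>y\<close> to
  \<open>z\<close>, is less than \<open>- \<tau>\<close>; this is what the assumption \<open>slack\<close> says. Together with \<open>cos \<phi> \<le> x \<bullet> y\<close> it
  puts \<open>x\<close> into a smaller cap of angle \<open>\<psi>\<close> around the direction of \<open>cos \<phi> *\<^sub>R y - \<tau> *\<^sub>R w\<close>.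
\<close>

lemma measure_cap_difference_le:
  fixes y z :: "'a::euclidean_space"
  assumes dim: "DIM('a) \<ge> 2" and yz: "norm y = 1" "norm z = 1" "cos \<epsilon> \<le> z \<bullet> y" and \<epsilon>: "0 \<le> \<epsilon>" "\<epsilon> \<le> pi / 2"
    and phi: "0 < \<phi>'" "\<phi>' \<le> \<phi>\<^sub>1" "\<phi>\<^sub>1 \<le> \<phi>" "\<phi> < pi / 2" and \<tau>: "0 \<le> \<tau>"
    and slack: "\<And>\<theta>. 0 \<le> \<theta> \<Longrightarrow> \<theta> \<le> \<epsilon> \<Longrightarrow> cos \<phi>\<^sub>1 \<le> cos \<theta> * cos \<phi>' - sin \<theta> * \<tau>"
    and \<psi>: "0 < \<psi>" "\<psi> < pi / 2" "(cos \<psi>)\<^sup>2 = (cos \<phi>)\<^sup>2 + \<tau>\<^sup>2"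
  shows "measure sphere_uniform {x. cos \<phi>' \<le> x \<bullet> y \<and> x \<bullet> z < cos \<phi>\<^sub>1} \<le> cap_fraction TYPE('a) \<psi>"
    (is "measure _ ?S \<le> _")
proof -
  have yy: "y \<bullet> y = 1" "z \<bullet> z = 1" using yz by (auto simp: norm_eq_1)
  have c: "cos \<phi> > 0" "cos \<psi> > 0" using phi \<psi> by (auto intro!: cos_gt_zero)
  have cc: "cos \<phi>\<^sub>1 \<le> cos \<phi>'" "cos \<phi> \<le> cos \<phi>'" using phi by (auto intro!: cos_monotone_0_pi_le)
  have zy1: "\<bar>z \<bullet> y\<bar> \<le> 1" using Cauchy_Schwarz_ineq2[of z y] yz by simp
  define \<theta> where "\<theta> = arccos (z \<bullet> y)"
  have \<theta>: "cos \<theta> = z \<bullet> y" "0 \<le> \<theta>" "\<theta> \<le> pi" using zy1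
    by (auto simp: \<theta>_def intro!: cos_arccos_abs arccos_lbound arccos_ubound)
  have \<theta>\<epsilon>: "\<theta> \<le> \<epsilon>" using yz(3) \<theta> \<epsilon> cos_mono_le_eq[of \<epsilon> \<theta>] by (simp add: \<theta>(1))
  show ?thesis
  proof (cases "\<theta> = 0")
    case True
    then have "z \<bullet> y = 1" using \<theta> by simp
    then have "z = y" using norm_cauchy_schwarz_eq[of z y] yz by simp
    then have "?S = {}" using cc by auto
    then show ?thesis using cap_fraction_pos[OF dim \<psi>(1,2)] by (simp del: Collect_empty_eq)
  next
    case False
    then have s: "sin \<theta> > 0" using \<theta> \<theta>\<epsilon> \<epsilon> by (intro sin_gt_zero) auto
    have c\<theta>: "cos \<theta> \<ge> 0" using \<theta> \<theta>\<epsilon> \<epsilon> by (intro cos_ge_zero) auto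
    define w where "w = (1 / sin \<theta>) *\<^sub>R (z - cos \<theta> *\<^sub>R y)"
    have zw: "z = cos \<theta> *\<^sub>R y + sin \<theta> *\<^sub>R w" using s by (simp add: w_def)
    have wy: "w \<bullet> y = 0" using yy by (simp add: w_def inner_diff \<theta>(1))
    have "(sin \<theta>)\<^sup>2 * (w \<bullet> w) = (z - cos \<theta> *\<^sub>R y) \<bullet> (z - cos \<theta> *\<^sub>R y)"
      using s by (simp add: w_def power2_eq_square)
    also have "\<dots> = 1 - (cos \<theta>)\<^sup>2"
      using yy by (simp add: inner_diff \<theta>(1) inner_commute power2_eq_square)
    also have "\<dots> = (sin \<theta>)\<^sup>2" by (simp add: sin_squared_eq)
    finally have ww: "w \<bullet> w = 1" using s by simp
    define u where "u = (1 / cos \<psi>) *\<^sub>R (cos \<phi> *\<^sub>R y - \<tau> *\<^sub>R w)"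
    have "u \<bullet> u = ((cos \<phi>)\<^sup>2 + \<tau>\<^sup>2) / (cos \<psi>)\<^sup>2"
      using yy ww wy by (simp add: u_def inner_diff inner_commute power2_eq_square)
    then have "norm u = 1" using c \<psi>(3) by (simp add: norm_eq_1)
    have "?S \<subseteq> {x. cos \<psi> \<le> x \<bullet> u}"
    proof
      fix x assume "x \<in> ?S"
      then have x: "cos \<phi>' \<le> x \<bullet> y" "x \<bullet> z < cos \<phi>\<^sub>1" by auto
      have "x \<bullet> z = cos \<theta> * (x \<bullet> y) + sin \<theta> * (x \<bullet> w)"
        by (subst zw) (simp add: inner_add_right)
      moreover have "cos \<theta> * cos \<phi>' \<le> cos \<theta> * (x \<bullet> y)" using x c\<theta> by (simp add: mult_left_mono)
      moreover have "cos \<phi>\<^sub>1 \<le> cos \<theta> * cos \<phi>' - sin \<theta> * \<tau>" using \<theta> \<theta>\<epsilon> by (intro slack)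
      ultimately have "sin \<theta> * (x \<bullet> w) < sin \<theta> * (- \<tau>)" using x(2) by simp
      then have "x \<bullet> w \<le> - \<tau>" using s by (simp only: mult_less_cancel_left_pos less_imp_le)
      then have "\<tau> * (x \<bullet> w) \<le> \<tau> * (- \<tau>)" using \<tau> by (intro mult_left_mono)
      moreover have "cos \<phi> * cos \<phi> \<le> cos \<phi> * (x \<bullet> y)" using x cc c by (intro mult_left_mono) auto
      ultimately have "(cos \<psi>)\<^sup>2 \<le> x \<bullet> (cos \<phi> *\<^sub>R y - \<tau> *\<^sub>R w)"
        unfolding \<psi>(3) by (simp add: inner_diff_right power2_eq_square)
      then show "x \<in> {x. cos \<psi> \<le> x \<bullet> u}"
        using c by (simp add: u_def pos_le_divide_eq power2_eq_square)
    qed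
    then have "measure sphere_uniform ?S \<le> measure sphere_uniform {x. cos \<psi> \<le> x \<bullet> u}"
      by (intro sphere_uniform.finite_measure_mono) auto
    also have "\<dots> = cap_fraction TYPE('a) \<psi>"
      by (rule measure_halfspace[OF dim \<open>norm u = 1\<close> \<psi>(1,2)])
    finally show ?thesis .
  qed
qed

lemma prod_list_if_const:
  fixes c :: "'b::comm_monoid_mult"
  shows "prod_list (map (\<lambda>x. if P x then c else 1) xs) = c ^ length (filter P xs)"
  by (induction xs) auto

text \<open>
  A Chernoff-type bound: the left-hand side dominates the indicator of \<open>k \<le> s\<close> for \<open>b \<le> 1\<close> and that of
  \<open>k \<ge> s\<close> for \<open>b \<ge> 1\<close>. In the first case \<open>k\<close> hits are too few, in the second one they are enough.
\<close>

lemma powr_diff_ge_one: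
  fixes b s :: real
  assumes "0 < b" "(b \<le> 1 \<and> real k \<le> s) \<or> (1 \<le> b \<and> s \<le> real k)"
  shows "1 \<le> b powr (- s) * b ^ k"
proof -
  have "b powr (- s) * b ^ k = b powr (real k - s)"
    using assms by (simp add: powr_realpow[symmetric] flip: powr_add)
  also have "1 = b powr 0" using assms by simp
  have "b powr 0 \<le> b powr (real k - s)"
    using assms powr_mono[of 0 "real k - s" b] powr_mono'[of "real k - s" 0 b] by auto
  finally show ?thesis using assms by simp
qed

text \<open>
  \<open>Y\<close> is a net with spacing \<open>\<epsilon>\<close> and \<open>Z\<close> one with spacing \<open>\<mu>\<close>. A center hits \<open>y \<in> Y\<close> if it is within \<open>\<phi>'\<close> of
  \<open>y\<close>, and covers \<open>z \<in> Z\<close> if it is within \<open>\<phi>\<^sub>1\<close> of \<open>z\<close>; the caps of angle \<open>\<phi>\<close> around a covering center and around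
  \<open>z\<close> itself then contain everything within \<open>\<mu>\<close> of \<open>z\<close>, and so does the cap of angle \<open>\<phi>\<close> around the
  nearest \<open>y\<close>. The second summand of the bound estimates
  the number of \<open>y\<close> with less than \<open>s\<close> hits, the third one the number of uncovered \<open>z\<close> whose nearest \<open>y\<close>
  has at least \<open>s\<close> hits. In the third summand a center contributes the factor \<open>0\<close> if it covers \<open>z\<close>, \<open>\<gamma>\<close> if it
  hits \<open>y\<close> without covering \<open>z\<close>, and \<open>1\<close> otherwise; as the middle case is rare, a large \<open>\<gamma>\<close> is affordable.
\<close>

lemma two_scale_covering:
  assumes dim: "DIM('a::euclidean_space) \<ge> 2"
    and \<epsilon>: "0 < \<epsilon>" "0 < \<mu>" "\<epsilon> + \<mu> \<le> \<phi>"
    and phi: "0 < \<phi>'" "\<phi>' \<le> \<phi>\<^sub>1" "\<phi>\<^sub>1 + \<mu> \<le> \<phi>" "\<phi> < pi / 2" and \<tau>: "0 \<le> \<tau>"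
    and slack: "\<And>\<theta>. 0 \<le> \<theta> \<Longrightarrow> \<theta> \<le> \<epsilon> \<Longrightarrow> cos \<phi>\<^sub>1 \<le> cos \<theta> * cos \<phi>' - sin \<theta> * \<tau>"
    and \<psi>: "0 < \<psi>" "\<psi> < pi / 2" "(cos \<psi>)\<^sup>2 = (cos \<phi>)\<^sup>2 + \<tau>\<^sup>2"
    and \<beta>: "0 < \<beta>" "\<beta> \<le> 1" and \<gamma>: "1 \<le> \<gamma>"
  obtains X :: "'a::euclidean_space set" where "finite X" "X \<subseteq> sphere 0 1"
    "\<And>u. u \<in> sphere 0 1 \<Longrightarrow> \<exists>x\<in>X. cos \<phi> \<le> u \<bullet> x"
    "real (card X) \<le> real N
       + \<beta> powr (- s) * (1 - (1 - \<beta>) * cap_fraction TYPE('a) \<phi>') ^ N / cap_fraction TYPE('a) (\<epsilon> / 2)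
       + \<gamma> powr (- s) * (1 - cap_fraction TYPE('a) \<phi>\<^sub>1 + \<gamma> * cap_fraction TYPE('a) \<psi>) ^ N
           / cap_fraction TYPE('a) (\<mu> / 2)"
proof -
  let ?V = "cap_fraction TYPE('a)"
  let ?M = "sphere_uniform :: 'a measure"
  obtain Y :: "'a set" where Y: "Y \<subseteq> sphere 0 1" "finite Y"
      "\<And>u. u \<in> sphere 0 1 \<Longrightarrow> \<exists>y\<in>Y. cos \<epsilon> \<le> u \<bullet> y" "real (card Y) * ?V (\<epsilon> / 2) \<le> measure ?M UNIV"
    by (rule maximal_separated_set[OF dim, of \<epsilon> "sphere 0 1" UNIV]) (use \<epsilon> phi in auto)
  obtain Z :: "'a set" where Z: "Z \<subseteq> sphere 0 1" "finite Z"
      "\<And>u. u \<in> sphere 0 1 \<Longrightarrow> \<exists>z\<in>Z. cos \<mu> \<le> u \<bullet> z" "real (card Z) * ?V (\<mu> / 2) \<le> measure ?M UNIV"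
    by (rule maximal_separated_set[OF dim, of \<mu> "sphere 0 1" UNIV]) (use \<epsilon> phi in auto)
  obtain near where near: "\<And>u. u \<in> sphere 0 1 \<Longrightarrow> near u \<in> Y \<and> cos \<epsilon> \<le> u \<bullet> near u"
    using Y(3) by metis
  have M1: "measure ?M UNIV = 1" using sphere_uniform.prob_space by simp
  have Vpos: "?V (\<epsilon> / 2) > 0" "?V (\<mu> / 2) > 0" using dim \<epsilon> phi by (auto intro!: cap_fraction_pos)
  define hits where "hits = (\<lambda>y x :: 'a. cos \<phi>' \<le> x \<bullet> y)"
  define covers where "covers = (\<lambda>z x :: 'a. cos \<phi>\<^sub>1 \<le> x \<bullet> z)"
  \<comment> \<open>One factor per center: \<open>Inl\<close> for the coarse and \<open>Inr\<close> for the fine points.\<close>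
  define f where "f = case_sum (\<lambda>y x. if hits y x then \<beta> else 1)
    (\<lambda>z x. if covers z x then 0 else if hits (near z) x then \<gamma> else 1)"
  define c where "c = case_sum (\<lambda>y::'a. 1 - (1 - \<beta>) * ?V \<phi>') (\<lambda>z::'a. 1 - ?V \<phi>\<^sub>1 + \<gamma> * ?V \<psi>)"
  define a where "a = case_sum (\<lambda>y::'a. \<beta> powr (- s)) (\<lambda>z::'a. \<gamma> powr (- s))"
  have meas[measurable]: "{x. hits y x} \<in> sets borel" "{x. covers z x} \<in> sets borel" for y z
    unfolding hits_def covers_def by measurable
  have mh: "measure ?M {x. hits y x} = ?V \<phi>'" if "y \<in> Y" for y
    unfolding hits_def using that Y(1) dim phi \<epsilon> by (intro measure_halfspace) auto
  have mc: "measure ?M {x. covers z x} = ?V \<phi>\<^sub>1" if "z \<in> Z" for z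
    unfolding covers_def using that Z(1) dim phi \<epsilon> by (intro measure_halfspace) auto
  have md: "measure ?M {x. hits (near z) x \<and> \<not> covers z x} \<le> ?V \<psi>" if "z \<in> Z" for z
  proof -
    have "norm z = 1" "norm (near z) = 1" "cos \<epsilon> \<le> z \<bullet> near z"
    proof -
      have z: "z \<in> sphere 0 1" using that Z(1) by blast
      then have "near z \<in> sphere 0 1" using near Y(1) by blast
      then show "norm z = 1" "norm (near z) = 1" "cos \<epsilon> \<le> z \<bullet> near z" using z near[OF z] by auto
    qed
    then show ?thesis unfolding hits_def covers_def not_le
      using dim phi \<epsilon> \<tau> slack \<psi> by (intro measure_cap_difference_le[where \<epsilon> = \<epsilon> and \<phi> = \<phi> and \<tau> = \<tau>]) auto
  qed
  have f_hit: "f (Inl y) = (\<lambda>x. 1 - (1 - \<beta>) * indicator {x. hits y x} x)" for y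
    by (auto simp: f_def indicator_def fun_eq_iff)
  \<comment> \<open>A center that covers \<open>z\<close> contributes \<open>0\<close> even if it also hits \<open>near z\<close>.\<close>
  have f_cov: "f (Inr z) = (\<lambda>x. 1 - indicator {x. covers z x} x
      + (\<gamma> - 1) * indicator {x. hits (near z) x \<and> \<not> covers z x} x)" for z
    by (auto simp: f_def indicator_def fun_eq_iff)
  have [measurable]: "{x. hits (near z) x \<and> \<not> covers z x} \<in> sets borel" for z
    unfolding hits_def covers_def by measurable
  have ind: "integrable ?M (indicator A :: 'a \<Rightarrow> real)" if "A \<in> sets borel" for A
    using that by (intro integrable_real_indicator) (auto simp: less_top[symmetric])
  have int: "integrable ?M (f j)" for j
    by (cases j) (auto simp: f_hit f_cov intro!: Bochner_Integration.integrable_add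
        Bochner_Integration.integrable_diff integrable_mult_right ind)
  have exp: "integral\<^sup>L ?M (f j) \<le> c j" if "j \<in> Y <+> Z" for j
  proof (cases j)
    case (Inl y)
    have "integral\<^sup>L ?M (f j) = 1 - (1 - \<beta>) * measure ?M {x. hits y x}"
      unfolding Inl f_hit using M1 ind[OF meas(1)]
      by (subst Bochner_Integration.integral_diff) auto
    then show ?thesis using Inl that mh by (auto simp: c_def)
  next
    case (Inr z)
    then have z: "z \<in> Z" using that by auto
    let ?C = "{x. covers z x}" and ?D = "{x. hits (near z) x \<and> \<not> covers z x}"
    have i: "integrable ?M (indicator ?C :: 'a \<Rightarrow> real)" "integrable ?M (indicator ?D :: 'a \<Rightarrow> real)"
      by (intro ind; measurable)+
    have "integral\<^sup>L ?M (f j) = (\<integral>x. 1 - indicator ?C x \<partial>?M) + (\<integral>x. (\<gamma> - 1) * indicator ?D x \<partial>?M)"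
      unfolding Inr f_cov using i
      by (intro Bochner_Integration.integral_add Bochner_Integration.integrable_diff integrable_mult_right) auto
    also have "(\<integral>x. 1 - indicator ?C x \<partial>?M) = 1 - measure ?M ?C"
      using i M1 by (subst Bochner_Integration.integral_diff) auto
    finally have "integral\<^sup>L ?M (f j) = 1 - ?V \<phi>\<^sub>1 + (\<gamma> - 1) * measure ?M {x. hits (near z) x \<and> \<not> covers z x}"
      using mc[OF z] by simp
    also have "\<dots> \<le> 1 - ?V \<phi>\<^sub>1 + \<gamma> * ?V \<psi>"
      using md[OF z] \<gamma> by (intro add_left_mono mult_mono) auto
    finally show ?thesis using Inr by (simp add: c_def)
  qed
  have nonneg: "0 \<le> f j x" "0 \<le> a j" for j x
    using \<beta> \<gamma> by (cases j; simp add: f_def a_def)+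
  have fin: "finite (Y <+> Z)" using Y Z by simp
  obtain xs where xs: "length xs = N" "set xs \<subseteq> sphere 0 1" and
    pot: "(\<Sum>j\<in>Y <+> Z. a j * prod_list (map (f j) xs)) \<le> (\<Sum>j\<in>Y <+> Z. a j * c j ^ N)"
    by (rule exists_points_product_potential[OF fin, of f c a N]) (use int exp nonneg in auto)
  define k where "k = (\<lambda>y. length (filter (hits y) xs))"
  define Yb where "Yb = {y \<in> Y. real (k y) < s}"
  define Zb where "Zb = {z \<in> Z. (\<forall>x\<in>set xs. \<not> covers z x) \<and> s \<le> real (k (near z))}"
  have "real (card Yb) = (\<Sum>y\<in>Yb. 1)" by simp
  also have "\<dots> \<le> (\<Sum>y\<in>Yb. a (Inl y) * prod_list (map (f (Inl y)) xs))"
  proof (rule sum_mono)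
    fix y assume "y \<in> Yb"
    then show "1 \<le> a (Inl y) * prod_list (map (f (Inl y)) xs)"
      using \<beta> by (simp add: a_def f_def prod_list_if_const powr_diff_ge_one Yb_def k_def)
  qed
  also have "\<dots> \<le> (\<Sum>y\<in>Y. a (Inl y) * prod_list (map (f (Inl y)) xs))"
    using Y nonneg by (intro sum_mono2) (auto simp: Yb_def intro!: mult_nonneg_nonneg prod_list_nonneg)
  finally have cY: "real (card Yb) \<le> (\<Sum>y\<in>Y. a (Inl y) * prod_list (map (f (Inl y)) xs))" .
  have "real (card Zb) = (\<Sum>z\<in>Zb. 1)" by simp
  also have "\<dots> \<le> (\<Sum>z\<in>Zb. a (Inr z) * prod_list (map (f (Inr z)) xs))"
  proof (rule sum_mono)
    fix z assume z: "z \<in> Zb"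
    have "map (f (Inr z)) xs = map (\<lambda>x. if hits (near z) x then \<gamma> else 1) xs"
      using z by (intro map_cong) (auto simp: f_def Zb_def)
    then show "1 \<le> a (Inr z) * prod_list (map (f (Inr z)) xs)"
      using \<gamma> z by (simp only: prod_list_if_const) (simp add: a_def powr_diff_ge_one Zb_def k_def)
  qed
  also have "\<dots> \<le> (\<Sum>z\<in>Z. a (Inr z) * prod_list (map (f (Inr z)) xs))"
    using Z nonneg by (intro sum_mono2) (auto simp: Zb_def intro!: mult_nonneg_nonneg prod_list_nonneg)
  finally have cZ: "real (card Zb) \<le> (\<Sum>z\<in>Z. a (Inr z) * prod_list (map (f (Inr z)) xs))" .
  have "real (card Yb) + real (card Zb) \<le> (\<Sum>j\<in>Y <+> Z. a j * c j ^ N)"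
    using cY cZ pot Y(2) Z(2) by (simp add: sum.Plus)
  also have "\<dots> = real (card Y) * (\<beta> powr (- s) * (1 - (1 - \<beta>) * ?V \<phi>') ^ N)
      + real (card Z) * (\<gamma> powr (- s) * (1 - ?V \<phi>\<^sub>1 + \<gamma> * ?V \<psi>) ^ N)"
    using Y(2) Z(2) by (simp add: sum.Plus a_def c_def)
  also have "\<dots> \<le> 1 / ?V (\<epsilon> / 2) * (\<beta> powr (- s) * (1 - (1 - \<beta>) * ?V \<phi>') ^ N)
      + 1 / ?V (\<mu> / 2) * (\<gamma> powr (- s) * (1 - ?V \<phi>\<^sub>1 + \<gamma> * ?V \<psi>) ^ N)"
  proof (intro add_mono mult_right_mono)
    show "real (card Y) \<le> 1 / ?V (\<epsilon> / 2)" "real (card Z) \<le> 1 / ?V (\<mu> / 2)"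
      using Y(4) Z(4) Vpos M1 by (simp_all add: pos_le_divide_eq)
    have "(1 - \<beta>) * ?V \<phi>' \<le> 1 * 1"
      using \<beta> dim phi \<epsilon> by (intro mult_mono cap_fraction_le_1) (auto intro!: less_imp_le cap_fraction_pos)
    then show "0 \<le> \<beta> powr (- s) * (1 - (1 - \<beta>) * ?V \<phi>') ^ N" by simp
    have "?V \<phi>\<^sub>1 \<le> 1" using dim phi \<epsilon> by (intro cap_fraction_le_1) auto
    moreover have "0 \<le> ?V \<psi>" using cap_fraction_pos[OF dim \<psi>(1,2)] by simp
    ultimately have "0 \<le> 1 - ?V \<phi>\<^sub>1 + \<gamma> * ?V \<psi>" using \<gamma> by simp
    then show "0 \<le> \<gamma> powr (- s) * (1 - ?V \<phi>\<^sub>1 + \<gamma> * ?V \<psi>) ^ N"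
      using \<gamma> by simp
  qed
  finally have bad: "real (card Yb) + real (card Zb) \<le> \<beta> powr (- s) * (1 - (1 - \<beta>) * ?V \<phi>') ^ N / ?V (\<epsilon> / 2)
      + \<gamma> powr (- s) * (1 - ?V \<phi>\<^sub>1 + \<gamma> * ?V \<psi>) ^ N / ?V (\<mu> / 2)" by simp
  show ?thesis
  proof (rule that[of "set xs \<union> Yb \<union> Zb"])
    show "finite (set xs \<union> Yb \<union> Zb)" "set xs \<union> Yb \<union> Zb \<subseteq> sphere 0 1"
      using xs(2) Y Z by (auto simp: Yb_def Zb_def)
    have "card (set xs \<union> Yb \<union> Zb) \<le> card (set xs) + card Yb + card Zb"
      by (meson add_le_mono card_Un_le order.trans order_refl)
    also have "card (set xs) \<le> N" using card_length[of xs] xs(1) by simp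
    finally show "real (card (set xs \<union> Yb \<union> Zb)) \<le> real N
       + \<beta> powr (- s) * (1 - (1 - \<beta>) * ?V \<phi>') ^ N / ?V (\<epsilon> / 2)
       + \<gamma> powr (- s) * (1 - ?V \<phi>\<^sub>1 + \<gamma> * ?V \<psi>) ^ N / ?V (\<mu> / 2)"
      using bad by linarith
  next
    fix u :: 'a assume u: "u \<in> sphere 0 1"
    obtain z where z: "z \<in> Z" "cos \<mu> \<le> u \<bullet> z" using Z(3)[OF u] by blast
    have zs: "z \<in> sphere 0 1" using z Z by auto
    have widen: "cos \<phi> \<le> cos \<alpha>" if "0 \<le> \<alpha>" "\<alpha> \<le> \<phi>" for \<alpha>
      using that phi by (intro cos_monotone_0_pi_le) auto
    \<comment> \<open>If no center covers \<open>z\<close>, then \<open>z\<close> or the coarse point near \<open>z\<close> is exceptional and has become a center.\<close>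
    consider (covered) x where "x \<in> set xs" "covers z x" | (few) "near z \<in> Yb" | (bad) "z \<in> Zb"
      using z near[OF zs] by (force simp: Yb_def Zb_def)
    then show "\<exists>x\<in>set xs \<union> Yb \<union> Zb. cos \<phi> \<le> u \<bullet> x"
    proof cases
      case covered
      have "cos (\<mu> + \<phi>\<^sub>1) \<le> u \<bullet> x"
        using covered u zs z(2) xs(2) \<epsilon> phi
        by (intro cos_angle_triangle[where y = z]) (auto simp: covers_def inner_commute)
      then show ?thesis using covered widen[of "\<mu> + \<phi>\<^sub>1"] \<epsilon> phi by force
    next
      case few
      have "cos (\<mu> + \<epsilon>) \<le> u \<bullet> near z"
        using near[OF zs] Y(1) u zs z(2) \<epsilon> phi
        by (intro cos_angle_triangle[where y = z]) auto
      then show ?thesis using few widen[of "\<mu> + \<epsilon>"] \<epsilon> phi by force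
    next
      case bad
      then show ?thesis using z(2) widen[of \<mu>] \<epsilon> phi by force
    qed
  qed
qed

section \<open>The density in small dimension\<close>

lemma one_minus_power_le_exp:
  fixes x :: real
  assumes "x \<le> 1"
  shows "(1 - x) ^ N \<le> exp (- (real N * x))"
proof -
  have "(1 - x) ^ N \<le> exp (- x) ^ N"
    using assms exp_ge_add_one_self[of "- x"] by (intro power_mono) auto
  then show ?thesis by (simp add: exp_of_nat_mult[symmetric])
qed

lemma exp_one_bounds: "271 / 100 \<le> exp (1::real)" "exp (1::real) \<le> 272 / 100"
proof -
  have "\<bar>exp 1 - 5837465777 / 2147483648\<bar> \<le> (1 / 1000 :: real)"
    using e_approx_32 by (rule order_trans) simp
  then show "271 / 100 \<le> exp (1::real)" "exp (1::real) \<le> 272 / 100"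
    unfolding abs_le_iff by linarith+
qed

lemma ln_le_iff_power:
  fixes x :: real
  assumes "x > 0" "b > 0"
  shows "real a / real b \<le> ln x \<longleftrightarrow> exp 1 ^ a \<le> x ^ b" "ln x \<le> real a / real b \<longleftrightarrow> x ^ b \<le> exp 1 ^ a"
proof -
  have "ln x * real b = ln (x ^ b)" "real a = ln (exp 1 ^ a)"
    using assms by (simp_all add: ln_realpow flip: exp_of_nat_mult)
  moreover have "real a / real b \<le> ln x \<longleftrightarrow> real a \<le> ln x * real b"
     "ln x \<le> real a / real b \<longleftrightarrow> ln x * real b \<le> real a"
    using assms by (simp_all add: pos_divide_le_eq pos_le_divide_eq)
  ultimately show "real a / real b \<le> ln x \<longleftrightarrow> exp 1 ^ a \<le> x ^ b" "ln x \<le> real a / real b \<longleftrightarrow> x ^ b \<le> exp 1 ^ a"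
    using assms by (simp_all only: ln_le_cancel_iff zero_less_power exp_gt_zero)
qed

text \<open>
  Logarithms of concrete numbers are estimated by comparing integer powers of rational numbers.
\<close>

lemma ln_lower_bound:
  fixes x :: real
  assumes "(272 / 100) ^ a \<le> x ^ b" "x > 0" "b > 0"
  shows "real a / real b \<le> ln x"
  unfolding ln_le_iff_power[OF assms(2,3)]
  using power_mono[OF exp_one_bounds(2), of a] assms(1) by simp

lemma ln_upper_bound:
  fixes x :: real
  assumes "x ^ b \<le> (271 / 100) ^ a" "x > 0" "b > 0"
  shows "ln x \<le> real a / real b"
  unfolding ln_le_iff_power[OF assms(2,3)]
  using power_mono[OF exp_one_bounds(1), of a] assms(1) by simp

text \<open>
  The number of random centers is chosen such that the uncovered fraction is at most
  \<open>(\<eta> / (1 - \<eta>)) ^ n\<close>. This minimizes the sum of random and additional centers when caps are replaced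
  by Euclidean balls. The final \<open>1\<close> pays for rounding the number of centers.
\<close>

lemma one_scale_density:
  assumes dim: "DIM('a::euclidean_space) = n + 1" "n \<ge> 2" and phi: "0 < \<phi>" "\<phi> < pi / 2" and \<eta>: "0 < \<eta>" "\<eta> \<le> 1 / 2"
  obtains X :: "'a::euclidean_space set" where "finite X" "X \<subseteq> sphere 0 1" "\<And>u. u \<in> sphere 0 1 \<Longrightarrow> \<exists>x\<in>X. cos \<phi> \<le> u \<bullet> x"
    "real (card X) * cap_fraction TYPE('a) \<phi> \<le> (1 / (1 - \<eta>)) ^ n * (1 + real n * ln ((1 - \<eta>) / \<eta>)) + 1"
proof -
  let ?V = "cap_fraction TYPE('a)"
  define V0 where "V0 = ?V ((1 - \<eta>) * \<phi>)"
  define V1 where "V1 = ?V (\<eta> * \<phi>)"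
  define R where "R = (1 / (1 - \<eta>)) ^ n"
  have dim2: "DIM('a) \<ge> 2" using dim by simp
  have half: "(1 - \<eta>) * \<phi> \<le> 1 * \<phi>" "\<eta> * \<phi> \<le> 1 / 2 * \<phi>" using \<eta> phi by (auto intro!: mult_right_mono)
  have small: "0 < (1 - \<eta>) * \<phi>" "(1 - \<eta>) * \<phi> < pi / 2" "0 < \<eta> * \<phi>" "\<eta> * \<phi> < pi / 2"
  proof -
    show "0 < (1 - \<eta>) * \<phi>" "0 < \<eta> * \<phi>" using \<eta> phi by auto
    show "(1 - \<eta>) * \<phi> < pi / 2" "\<eta> * \<phi> < pi / 2" using half phi by linarith+
  qed
  have V: "0 < V0" "V0 \<le> 1" "0 < V1" "0 < ?V \<phi>" "?V \<phi> \<le> 1"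
    unfolding V0_def V1_def using dim2 phi small by (auto intro!: cap_fraction_pos cap_fraction_le_1)
  have VV0: "?V \<phi> \<le> R * V0"
    using cap_fraction_ratio_angle[OF dim, of "(1 - \<eta>) * \<phi>" \<phi>] \<eta> phi small half by (simp add: V0_def R_def)
  have VV1: "?V \<phi> \<le> (1 / \<eta>) ^ n * V1"
    using cap_fraction_ratio_angle[OF dim, of "\<eta> * \<phi>" \<phi>] \<eta> phi small half by (simp add: V1_def)
  define \<Lambda> where "\<Lambda> = real n * ln ((1 - \<eta>) / \<eta>)"
  have \<Lambda>: "\<Lambda> \<ge> 0" using \<eta> by (simp add: \<Lambda>_def field_simps)
  define N where "N = nat \<lceil>\<Lambda> / V0\<rceil>"
  have "\<Lambda> / V0 \<ge> 0" using \<Lambda> V by simp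
  then have N: "\<Lambda> / V0 \<le> real N" "real N \<le> \<Lambda> / V0 + 1"
    unfolding N_def by linarith+
  obtain X :: "'a set" where X: "finite X" "X \<subseteq> sphere 0 1" "\<And>u. u \<in> sphere 0 1 \<Longrightarrow> \<exists>x\<in>X. cos \<phi> \<le> u \<bullet> x"
    "real (card X) \<le> real N + (1 - V0) ^ N / V1"
    unfolding V0_def V1_def
    by (rule one_scale_covering[OF dim2, of "(1 - \<eta>) * \<phi>" "\<eta> * \<phi>" \<phi> N])
      (use half small phi in \<open>auto simp: algebra_simps\<close>)
  have "(1 - V0) ^ N \<le> exp (- (real N * V0))" using V by (intro one_minus_power_le_exp)
  also have "\<dots> \<le> exp (- \<Lambda>)" using N(1) V by (simp add: pos_divide_le_eq)
  also have "\<dots> = (\<eta> / (1 - \<eta>)) ^ n"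
    using \<eta> by (simp add: \<Lambda>_def exp_minus exp_of_nat_mult power_divide)
  finally have un: "(1 - V0) ^ N \<le> (\<eta> / (1 - \<eta>)) ^ n" .
  have "real (card X) * ?V \<phi> \<le> (real N + (1 - V0) ^ N / V1) * ?V \<phi>"
    using X(4) V by (intro mult_right_mono) auto
  also have "\<dots> = real N * ?V \<phi> + (1 - V0) ^ N / V1 * ?V \<phi>" by (simp add: algebra_simps)
  also have "\<dots> \<le> (\<Lambda> * R + 1) + R"
  proof (rule add_mono)
    have "real N * ?V \<phi> \<le> (\<Lambda> / V0 + 1) * ?V \<phi>" using N(2) V by (intro mult_right_mono) auto
    also have "\<dots> = \<Lambda> / V0 * ?V \<phi> + ?V \<phi>" by (simp add: algebra_simps)
    also have "\<dots> \<le> \<Lambda> / V0 * (R * V0) + 1"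
      using VV0 \<Lambda> V by (intro add_mono mult_left_mono) auto
    finally show "real N * ?V \<phi> \<le> \<Lambda> * R + 1" using V by simp
    have "(1 - V0) ^ N / V1 * ?V \<phi> \<le> (\<eta> / (1 - \<eta>)) ^ n / V1 * ((1 / \<eta>) ^ n * V1)"
      using un VV1 V \<eta> by (intro mult_mono divide_right_mono) auto
    also have "\<dots> = R" using V \<eta> by (simp add: R_def power_divide)
    finally show "(1 - V0) ^ N / V1 * ?V \<phi> \<le> R" .
  qed
  finally have "real (card X) * ?V \<phi> \<le> R * (1 + \<Lambda>) + 1" by (simp add: algebra_simps)
  then show ?thesis using that X(1-3) by (simp add: R_def \<Lambda>_def)
qed

text \<open>
  The logarithm is concave and lies above \<open>x / 4\<close> at both ends of the interval; \<open>x = 4\<close> is the point where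
  the difference is largest.
\<close>

lemma ln_ge_quarter:
  fixes x :: real
  assumes "8 / 5 \<le> x" "x \<le> 8"
  shows "x / 4 \<le> ln x"
proof (cases "x \<le> 4")
  case True
  have "ln (8 / 5) - (8 / 5) / 4 \<le> ln x - x / 4"
    by (rule DERIV_nonneg_imp_nondecreasing[of "8/5" x "\<lambda>x. ln x - x / 4"])
      (use True assms in \<open>auto intro!: exI derivative_eq_intros simp: field_simps\<close>)
  moreover have "real 2 / real 5 \<le> ln (8 / 5)"
    by (rule ln_lower_bound) (simp_all add: power_divide)
  ultimately show ?thesis by simp
next
  case False
  have "ln x - x / 4 \<ge> ln 8 - 8 / 4"
    by (rule DERIV_nonpos_imp_nonincreasing[of x 8 "\<lambda>x. ln x - x / 4"])
      (use False assms in \<open>auto intro!: exI derivative_eq_intros simp: field_simps\<close>)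
  moreover have "real 2 / real 1 \<le> ln 8"
    by (rule ln_lower_bound) (simp_all add: power_divide)
  ultimately show ?thesis by simp
qed

text \<open>
  After \<open>ln (1 + L) \<le> ln L + 1 / L\<close> and division by \<open>n\<close>, the inequality says that \<open>(2 - 1 / L) * ln L\<close> exceeds
  \<open>L / 2\<close> up to small terms; \<open>L / 4 \<le> ln L\<close> suffices for that.
\<close>

lemma one_scale_bound_le:
  fixes L :: real and n :: nat
  assumes n: "n \<ge> 5" and L: "8 / 5 \<le> L" "L \<le> 8"
  shows "(1 + L) / L * (1 + real n * (L + ln (1 + L))) + 1 \<le> real n * (L / 2 + 3 * ln L + 3)"
proof -
  define l where "l = ln L"
  have "1 + L = L * (1 + 1 / L)" using L by (simp add: field_simps)
  then have "ln (1 + L) = ln (L * (1 + 1 / L))" by (rule arg_cong)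
  also have "\<dots> = l + ln (1 + 1 / L)"
    unfolding l_def using L by (intro ln_mult_pos add_pos_pos divide_pos_pos) auto
  also have "\<dots> \<le> l + 1 / L" using L by (intro add_left_mono ln_add_one_self_le_self) auto
  finally have ln1: "ln (1 + L) \<le> l + 1 / L" .
  have l: "L / 4 \<le> l" unfolding l_def using L by (rule ln_ge_quarter)
  have "1 / L \<le> 5 / 8" using L by (simp add: field_simps)
  define i where "i = 1 / L"
  have i: "0 < i" "i \<le> 5 / 8" "L * i = 1" using L by (auto simp: i_def field_simps)
  have "(1 + L) / L * (1 + real n * (L + ln (1 + L))) + 1 \<le> (1 + i) * (1 + real n * (L + (l + i))) + 1"
  proof -
    have "(1 + L) / L = 1 + i" using L by (simp add: i_def field_simps)
    then show ?thesis using ln1 i by (auto simp: i_def intro!: mult_left_mono)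
  qed
  also have "\<dots> \<le> (1 + i) * (real n / 5 + real n * (L + (l + i))) + real n / 5"
    using n i by (intro add_mono mult_left_mono) auto
  also have "\<dots> = real n * ((1 + i) * (1 / 5 + L + l + i) + 1 / 5)"
    by (simp add: algebra_simps)
  also have "\<dots> \<le> real n * (L / 2 + 3 * l + 3)"
  proof (rule mult_left_mono)
    have "(1 + i) * (1 / 5 + L + l + i) = 1 / 5 + L + l + i + i / 5 + L * i + i * l + i * i"
      by (simp add: algebra_simps add_divide_distrib)
    then have "(1 + i) * (1 / 5 + L + l + i) + 1 / 5 = 7 / 5 + L + l + i * (6 / 5) + i * l + i * i"
      using i(3) by simp
    moreover have "(2 - i) * (L / 4) \<le> (2 - i) * l" using l i by (intro mult_left_mono) auto
    moreover have "(2 - i) * (L / 4) = L / 2 - (L * i) / 4" by (simp add: field_simps)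
    moreover have "(2 - i) * l = 2 * l - i * l" by (simp add: algebra_simps)
    moreover have "i * i \<le> 5 / 8 * (5 / 8)" using i by (intro mult_mono) auto
    ultimately show "(1 + i) * (1 / 5 + L + l + i) + 1 / 5 \<le> L / 2 + 3 * l + 3"
      using i by linarith
  qed simp
  finally show ?thesis by (simp add: l_def)
qed

lemma one_minus_inverse_le_ln: "(0::real) < x \<Longrightarrow> 1 - 1 / x \<le> ln x"
  using ln_le_minus_one[of "1 / x"] by (simp add: ln_div)

text \<open>
  In general \<open>\<eta> = 1 / (n * (1 + ln n))\<close>, for which Bernoulli's inequality gives
  \<open>(1 - \<eta>) ^ n \<ge> ln n / (1 + ln n)\<close>. For \<open>n = 3\<close> and \<open>n = 4\<close> the estimates used in general are too crude, so
  the simpler \<open>\<eta> = 1 / (2 * n)\<close> is taken and the bound evaluated numerically.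
\<close>

lemma small_dimension_density:
  assumes n: "n \<ge> 3" "ln (real n) \<le> 8"
  obtains \<eta> :: real where "0 < \<eta>" "\<eta> \<le> 1 / 2"
    "(1 / (1 - \<eta>)) ^ n * (1 + real n * ln ((1 - \<eta>) / \<eta>)) + 1
      \<le> real n * (ln (real n) / 2 + 3 * ln (ln (real n)) + 3)"
proof -
  consider "n = 3" | "n = 4" | "n \<ge> 5" using n by linarith
  then show ?thesis
  proof cases
    case 1
    have l5: "ln 5 \<le> real 5 / real 3" by (rule ln_upper_bound) (simp_all add: power_divide)
    have l3: "real 12 / real 11 \<le> ln 3" by (rule ln_lower_bound) (simp_all add: power_divide)
    have "ln (12 / 11) \<le> ln (ln (3::real))" using l3 by (subst ln_le_cancel_iff) auto
    moreover have "1 / 12 \<le> ln (12 / 11 :: real)" using one_minus_inverse_le_ln[of "12 / 11"] by simp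
    ultimately have ll3: "1 / 12 \<le> ln (ln (3::real))" by linarith
    show ?thesis
      by (rule that[of "1 / 6"]) (use 1 l5 l3 ll3 in \<open>auto simp: power_divide\<close>)
  next
    case 2
    have l7: "ln 7 \<le> real 2 / real 1" by (rule ln_upper_bound) (simp_all add: power_divide)
    have l4: "real 11 / real 8 \<le> ln 4" by (rule ln_lower_bound) (simp_all add: power_divide)
    have "ln (11 / 8) \<le> ln (ln (4::real))" using l4 by (subst ln_le_cancel_iff) auto
    moreover have "3 / 11 \<le> ln (11 / 8 :: real)" using one_minus_inverse_le_ln[of "11 / 8"] by simp
    ultimately have ll4: "3 / 11 \<le> ln (ln (4::real))" by linarith
    show ?thesis
      by (rule that[of "1 / 8"]) (use 2 l7 l4 ll4 in \<open>auto simp: power_divide\<close>)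
  next
    case 3
    define L where "L = ln (real n)"
    have "real 8 / real 5 \<le> ln 5" by (rule ln_lower_bound) (simp_all add: power_divide)
    also have "ln 5 \<le> L" using 3 by (simp add: L_def)
    finally have L: "8 / 5 \<le> L" "L \<le> 8" using n by (auto simp: L_def)
    define \<eta> where "\<eta> = 1 / (real n * (1 + L))"
    have "5 * 2 \<le> real n * (1 + L)" using 3 L by (intro mult_mono) auto
    then have \<eta>: "0 < \<eta>" "\<eta> \<le> 1 / 2" by (auto simp: \<eta>_def field_simps)
    have "1 - real n * \<eta> \<le> (1 - \<eta>) ^ n"
      using Bernoulli_inequality[of "- \<eta>" n] \<eta> by (simp add: algebra_simps)
    moreover have "real n * \<eta> = 1 / (1 + L)" using 3 L by (simp add: \<eta>_def)
    moreover have "1 - 1 / (1 + L) = L / (1 + L)" using L by (simp add: field_simps)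
    ultimately have "L / (1 + L) \<le> (1 - \<eta>) ^ n" by simp
    then have R: "(1 / (1 - \<eta>)) ^ n \<le> (1 + L) / L"
      using L \<eta> by (simp add: power_divide field_simps)
    have "(1 - \<eta>) / \<eta> \<le> 1 / \<eta>" using \<eta> by (simp add: divide_right_mono)
    then have "ln ((1 - \<eta>) / \<eta>) \<le> ln (1 / \<eta>)" using \<eta> by (subst ln_le_cancel_iff) auto
    also have "\<dots> = L + ln (1 + L)" using 3 L by (simp add: \<eta>_def ln_mult L_def)
    finally have "(1 / (1 - \<eta>)) ^ n * (1 + real n * ln ((1 - \<eta>) / \<eta>)) + 1
        \<le> (1 + L) / L * (1 + real n * (L + ln (1 + L))) + 1"
      using R L \<eta> by (intro add_mono mult_mono mult_left_mono) (auto intro!: add_nonneg_nonneg mult_nonneg_nonneg simp: field_simps)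
    also have "\<dots> \<le> real n * (L / 2 + 3 * ln L + 3)"
      using 3 L by (rule one_scale_bound_le)
    finally show ?thesis using that \<eta> by (simp add: L_def)
  qed
qed

section \<open>The density in large dimension\<close>

lemma sin_ratio_le:
  fixes a b :: real
  assumes "0 < a" "a \<le> b" "b \<le> pi / 2"
  shows "sin b \<le> b / a * sin a"
proof -
  have "sin b / b \<le> sin a / a"
  proof (rule DERIV_nonpos_imp_nonincreasing[OF \<open>a \<le> b\<close>])
    fix x assume "a \<le> x" "x \<le> b"
    then have x: "0 < x" "x \<le> pi" using assms by auto
    have "((\<lambda>x. sin x / x) has_real_derivative (cos x * x - sin x * 1) / (x * x)) (at x)"
      using x by (intro DERIV_divide DERIV_sin DERIV_ident) auto
    moreover have "(cos x * x - sin x * 1) / (x * x) \<le> 0"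
      using x_cos_le_sin[of x] x by (simp add: divide_nonpos_pos mult.commute)
    ultimately show "\<exists>y. ((\<lambda>x. sin x / x) has_real_derivative y) (at x) \<and> y \<le> 0" by blast
  qed
  then show ?thesis using assms by (simp add: field_simps)
qed

lemma cos_diff_ge:
  fixes a b :: real
  assumes "0 \<le> a" "a \<le> b" "b \<le> pi / 2"
  shows "(b - a) * sin a \<le> cos a - cos b"
proof -
  have "cos a + a * sin a \<ge> cos b + b * sin a"
  proof (rule DERIV_nonpos_imp_nonincreasing[OF \<open>a \<le> b\<close>, of "\<lambda>x. cos x + x * sin a"])
    fix x assume x: "a \<le> x" "x \<le> b"
    have "((\<lambda>x. cos x + x * sin a) has_real_derivative - sin x + 1 * sin a) (at x)"
      by (intro DERIV_add DERIV_cos DERIV_cmult_right DERIV_ident)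
    moreover have "sin a \<le> sin x" using x assms by (intro sin_monotone_2pi_le) auto
    ultimately show "\<exists>y. ((\<lambda>x. cos x + x * sin a) has_real_derivative y) (at x) \<and> y \<le> 0"
      by (intro exI[of _ "- sin x + 1 * sin a"]) auto
  qed
  then show ?thesis by (simp add: algebra_simps)
qed

text \<open>
  Turning \<open>y\<close> by \<open>\<theta>\<close> lowers the inner product with a center by about \<open>\<epsilon>\<^sup>2 / 2 * cos \<phi>'\<close> because of the curvature of the
  sphere and by at most \<open>\<epsilon> * \<tau>\<close> because of the tangential component. What is available is the difference of the cosines, at least \<open>(\<phi>\<^sub>1 - \<phi>') * sin \<phi>'\<close>. The
  factor \<open>\<phi> / \<phi>'\<close> comes from comparing \<open>sin \<phi>\<close> with \<open>sin \<phi>'\<close>.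
\<close>

lemma two_scale_slack:
  fixes \<phi> \<phi>\<^sub>1 \<phi>' \<epsilon> \<tau> \<theta> :: real
  assumes phi: "0 < \<phi>'" "\<phi>' \<le> \<phi>\<^sub>1" "\<phi>\<^sub>1 \<le> \<phi>" "\<phi> < pi / 2" and \<theta>: "0 \<le> \<theta>" "\<theta> \<le> \<epsilon>" and \<tau>: "\<tau> = t * sin \<phi>" "0 \<le> t"
    and gap: "\<phi> / \<phi>' * (\<epsilon>\<^sup>2 / (2 * \<phi>) + \<epsilon> * t) \<le> \<phi>\<^sub>1 - \<phi>'"
  shows "cos \<phi>\<^sub>1 \<le> cos \<theta> * cos \<phi>' - sin \<theta> * \<tau>"
proof -
  have s: "0 < sin \<phi>'" "0 < cos \<phi>'" "0 < sin \<phi>" using phi by (auto intro!: sin_gt_zero cos_gt_zero)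
  have "(\<phi>\<^sub>1 - \<phi>') * sin \<phi>' \<le> cos \<phi>' - cos \<phi>\<^sub>1" using phi by (intro cos_diff_ge) auto
  moreover have "(1 - cos \<theta>) * cos \<phi>' \<le> \<epsilon>\<^sup>2 / (2 * \<phi>') * sin \<phi>'"
  proof -
    have "1 - cos \<theta> \<le> \<theta>\<^sup>2 / 2"
    proof -
      have "cos \<theta> = 1 - 2 * (sin (\<theta> / 2))\<^sup>2" using cos_double_sin[of "\<theta> / 2"] by simp
      moreover have "\<bar>sin (\<theta> / 2)\<bar> \<le> \<bar>\<theta> / 2\<bar>" by (rule abs_sin_x_le_abs_x)
      then have "(sin (\<theta> / 2))\<^sup>2 \<le> (\<theta> / 2)\<^sup>2" by (simp only: abs_le_square_iff)
      ultimately show ?thesis by (simp add: power2_eq_square)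
    qed
    also have "\<theta>\<^sup>2 / 2 \<le> \<epsilon>\<^sup>2 / 2" using \<theta> by (simp add: power_mono)
    finally have "(1 - cos \<theta>) * cos \<phi>' \<le> \<epsilon>\<^sup>2 / 2 * cos \<phi>'" using s by (intro mult_right_mono) auto
    also have "\<dots> \<le> \<epsilon>\<^sup>2 / 2 * (sin \<phi>' / \<phi>')"
      using x_cos_le_sin[of \<phi>'] phi by (intro mult_left_mono) (auto simp: pos_le_divide_eq mult.commute)
    finally show ?thesis using phi by (simp add: field_simps)
  qed
  moreover have "sin \<theta> * \<tau> \<le> \<epsilon> * t * (\<phi> / \<phi>') * sin \<phi>'"
  proof -
    have "sin \<theta> \<le> \<epsilon>" using sin_x_le_x[OF \<theta>(1)] \<theta> by simp
    then have "sin \<theta> * \<tau> \<le> \<epsilon> * (t * sin \<phi>)" unfolding \<tau>(1) using s \<tau> by (intro mult_right_mono) auto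
    also have "\<dots> \<le> \<epsilon> * (t * (\<phi> / \<phi>' * sin \<phi>'))"
      using sin_ratio_le[of \<phi>' \<phi>] phi \<theta> \<tau> by (intro mult_left_mono) auto
    finally show ?thesis by (simp add: mult_ac)
  qed
  moreover have "(\<epsilon>\<^sup>2 / (2 * \<phi>') + \<epsilon> * t * (\<phi> / \<phi>')) * sin \<phi>' \<le> (\<phi>\<^sub>1 - \<phi>') * sin \<phi>'"
    using gap phi s by (intro mult_right_mono) (auto simp: algebra_simps)
  ultimately show ?thesis by (simp add: algebra_simps)
qed

text \<open>
  Here \<open>n * \<l>\<close> is the density of the random caps. The fifth and the sixth inequality are the exponents of the numbers
  of exceptional coarse and fine points, divided by \<open>n\<close>. In the fifth one, \<open>L / 2\<close> and \<open>3 / 2 * ln L\<close>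
  come from the size of the coarse net and \<open>ln L / 2\<close> from requiring \<open>n / 2\<close> hits, which explains the summand
  \<open>2 * ln L\<close> in \<open>\<l>\<close>; the constant \<open>14 / 5\<close> exceeds \<open>ln 96 / 2 + 1 / 2\<close>. The last inequality is the final
  bound, where \<open>L / (L - 1)\<close> is the loss from shrinking the caps.
\<close>

lemma large_dimension_inequalities:
  fixes L \<l> n :: real
  assumes L: "L \<ge> 8" and n: "n = exp L" and l: "\<l> = L / 2 + 2 * ln L + 14 / 5"
  shows "2 * \<l> \<le> 3 * L" "0 < \<l>" "3 * L \<le> n" "4 * L \<le> n"
    "ln (32 * n * L ^ 3) / 2 + ln (2 * \<l>) / 2 + 1 / 2 \<le> \<l>"
    "ln (8 * n * L) - ln (n / (3 * L)) / 2 + 1 \<le> \<l>"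
    "n * (\<l> * (L / (L - 1))) + 3 \<le> n * (L / 2 + 3 * ln L + 3)"
proof -
  have "ln 8 \<le> real 21 / real 10" "real 2 / real 1 \<le> ln 8"
    by (rule ln_upper_bound ln_lower_bound; simp add: power_divide)+
  then have l8: "ln 8 \<le> (21 / 10 :: real)" "2 \<le> ln (8::real)" by simp_all
  have "ln (L / 8) \<le> L / 8 - 1" using L by (intro ln_le_minus_one) auto
  then have "ln L \<le> L / 8 + 11 / 10" using l8 L by (simp add: ln_div)
  then show l3: "2 * \<l> \<le> 3 * L" using L l by simp
  have lnL: "2 \<le> ln L" using l8(2) L by (meson ln_le_cancel_iff order.trans zero_less_numeral less_le_trans)
  then show lpos: "0 < \<l>" using L l by simp
  have "1 + L + L\<^sup>2 / 2 \<le> exp L" using exp_lower_Taylor_quadratic[of L] L by simp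
  moreover have "8 * L \<le> L\<^sup>2" using L by (simp add: power2_eq_square mult_right_mono)
  ultimately show n4: "4 * L \<le> n" using n L by simp
  then show n3: "3 * L \<le> n" using L by simp
  have npos: "0 < n" "ln n = L" using n by auto
  have "ln (2 * \<l>) \<le> ln (3 * L)" using l3 lpos L by (subst ln_le_cancel_iff) auto
  then have a: "ln (2 * \<l>) \<le> ln 3 + ln L" using L by (simp add: ln_mult)
  have b: "ln (32 * n * L ^ 3) = ln 32 + L + 3 * ln L"
    using L npos by (simp add: ln_mult ln_realpow)
  have "ln 32 + ln 3 = ln (96 :: real)" by (simp flip: ln_mult_pos)
  moreover have "ln 96 \<le> real 23 / real 5" by (rule ln_upper_bound) (simp_all add: power_divide)
  ultimately show "ln (32 * n * L ^ 3) / 2 + ln (2 * \<l>) / 2 + 1 / 2 \<le> \<l>"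
    using a b l by linarith
  have c: "ln (8 * n * L) = ln 8 + L + ln L" "ln (n / (3 * L)) = L - (ln 3 + ln L)"
    using L npos by (simp_all add: ln_mult ln_div)
  have "ln 8 + ln 3 = ln (24 :: real)" by (simp flip: ln_mult_pos)
  moreover have "ln 24 \<le> real 7 / real 2" by (rule ln_upper_bound) (simp_all add: power_divide)
  moreover have "ln 8 \<le> ln L" using L by (subst ln_le_cancel_iff) auto
  ultimately show "ln (8 * n * L) - ln (n / (3 * L)) / 2 + 1 \<le> \<l>"
    using c l by linarith
  have "\<l> / (L - 1) \<le> 12 / 7" using l3 L by (simp add: divide_le_eq)
  moreover have "\<l> * (L / (L - 1)) = \<l> + \<l> / (L - 1)" using L by (simp add: field_simps)
  ultimately have "\<l> * (L / (L - 1)) \<le> L / 2 + 3 * ln L + 3 - 1 / 5" using lnL l by linarith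
  then have "n * (\<l> * (L / (L - 1))) \<le> n * (L / 2 + 3 * ln L + 3 - 1 / 5)" using npos by (intro mult_left_mono) auto
  then show "n * (\<l> * (L / (L - 1))) + 3 \<le> n * (L / 2 + 3 * ln L + 3)"
    using n4 L by (simp add: algebra_simps)
qed

text \<open>
  The angles are \<open>\<phi>' = (1 - 1 / (n * L)) * \<phi>\<close>, \<open>\<mu> = \<phi> / (4 * n * L)\<close> and \<open>\<epsilon> = \<phi> / sqrt (8 * n * L ^ 3)\<close> with
  \<open>L = ln n\<close>. Shrinking \<open>\<phi>\<close> by the factor \<open>1 - 1 / (n * L)\<close> increases the density of about \<open>n * L / 2\<close> only by
  a multiple of \<open>n\<close>. A quarter of the room gained in this way is
  used for the fine net and about half of it for tangential components up to \<open>t * sin \<phi>\<close>, where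
  \<open>t = sqrt (2 * L / n)\<close> is chosen such that larger components have probability at most \<open>1 / n\<close>; this dictates
  \<open>\<epsilon> * t = \<phi> / (2 * n * L)\<close>.
\<close>

lemma large_dimension_density:
  assumes dim: "DIM('a::euclidean_space) = n + 1" and n: "ln (real n) \<ge> 8" and phi: "0 < \<phi>" "\<phi> < pi / 2"
  obtains X :: "'a::euclidean_space set" where "finite X" "X \<subseteq> sphere 0 1" "\<And>u. u \<in> sphere 0 1 \<Longrightarrow> \<exists>x\<in>X. cos \<phi> \<le> u \<bullet> x"
    "real (card X) * cap_fraction TYPE('a) \<phi> \<le> real n * (ln (real n) / 2 + 3 * ln (ln (real n)) + 3)"
proof -
  let ?V = "cap_fraction TYPE('a)"
  define m where "m = real n"
  define L where "L = ln m"
  define \<l> where "\<l> = L / 2 + 2 * ln L + 14 / 5"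
  have "n \<noteq> 0" using n by (intro notI) simp
  then have m: "m = exp L" "m > 0" by (auto simp: m_def L_def)
  have L: "L \<ge> 8" using n by (simp add: L_def m_def)
  note par = large_dimension_inequalities[OF L m(1) \<l>_def]
  have n2: "n \<ge> 2" using par(3) L by (simp add: m_def)
  have dim2: "DIM('a) \<ge> 2" using dim n2 by simp
  have mL: "256 \<le> m * L"
  proof -
    have "(4 * 8) * 8 \<le> m * L" using par(4) L by (intro mult_mono) auto
    then show ?thesis by simp
  qed
  define d where "d = \<phi> / (m * L)"
  have d: "0 < d" "d \<le> \<phi> / 256"
  proof -
    show "0 < d" unfolding d_def using phi mL by (intro divide_pos_pos) auto
    show "d \<le> \<phi> / 256" unfolding d_def using phi mL by (intro divide_left_mono) auto
  qed
  define \<mu> where "\<mu> = d / 4"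
  define \<epsilon> where "\<epsilon> = \<phi> / sqrt (8 * m * L ^ 3)"
  define \<phi>\<^sub>1 where "\<phi>\<^sub>1 = \<phi> - \<mu>"
  define \<phi>' where "\<phi>' = \<phi> - d"
  define x where "x = 2 * L / m"
  define t where "t = sqrt x"
  \<comment> \<open>This is the angle with \<open>(cos \<psi>)\<^sup>2 = (cos \<phi>)\<^sup>2 + (t * sin \<phi>)\<^sup>2\<close>.\<close>
  define \<psi> where "\<psi> = arcsin (sin \<phi> * sqrt (1 - x))"
  \<comment> \<open>With \<open>m * \<l>\<close> expected hits, this choice minimizes \<open>\<beta> powr (- m / 2) * exp (- (1 - \<beta>) * m * \<l>)\<close>.\<close>
  define \<beta> where "\<beta> = 1 / (2 * \<l>)"
  \<comment> \<open>Large, but with \<open>N * \<gamma> * V \<psi> \<le> m\<close>, so that it costs at most the factor \<open>exp m\<close>.\<close>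
  define \<gamma> where "\<gamma> = m / (3 * L)"
  have x: "0 < x" "x \<le> 1 / 2" using par(4) L m by (auto simp: x_def field_simps)
  have phi': "0 < \<phi>'" "\<phi>' \<le> \<phi>\<^sub>1" "\<phi>\<^sub>1 \<le> \<phi>" "\<phi>\<^sub>1 + \<mu> \<le> \<phi>" "0 < \<mu>" "\<phi>\<^sub>1 < pi / 2" "\<phi>' < pi / 2" "\<phi>' \<le> \<phi>" "\<mu> \<le> \<phi> / 4"
    using d phi by (auto simp: \<phi>'_def \<phi>\<^sub>1_def \<mu>_def)
  have s\<phi>: "0 < sin \<phi>" "0 < cos \<phi>" "sin \<phi> \<le> 1" using phi
    by (auto intro!: sin_gt_zero cos_gt_zero)
  have mL3: "0 < m * L ^ 3" "16 \<le> 8 * m * L ^ 3"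
  proof -
    show "0 < m * L ^ 3" using m L by simp
    have "2 * 1 \<le> m * L ^ 3" using par(4) L by (intro mult_mono) (auto simp: one_le_power)
    then show "16 \<le> 8 * m * L ^ 3" by simp
  qed
  have eps: "0 < \<epsilon>" "\<epsilon> \<le> \<phi> / 4"
  proof -
    show "0 < \<epsilon>" using phi mL3 by (simp add: \<epsilon>_def)
    have "4 \<le> sqrt (8 * m * L ^ 3)" using mL3 by (intro real_le_rsqrt) simp
    moreover have "0 < sqrt (8 * m * L ^ 3)" using mL3 by simp
    ultimately show "\<epsilon> \<le> \<phi> / 4" unfolding \<epsilon>_def using phi by (intro divide_left_mono) auto
  qed
  have gap: "\<phi> / \<phi>' * (\<epsilon>\<^sup>2 / (2 * \<phi>) + \<epsilon> * t) \<le> \<phi>\<^sub>1 - \<phi>'"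
  proof -
    have "\<epsilon>\<^sup>2 / (2 * \<phi>) = \<phi> / (16 * (m * L ^ 3))"
      using phi mL3 by (simp add: \<epsilon>_def power_divide power2_eq_square[of \<phi>])
    also have "\<dots> = d * (1 / (16 * L\<^sup>2))" using L m by (simp add: d_def power2_eq_square power3_eq_cube)
    also have "\<dots> \<le> d * (1 / (16 * 8\<^sup>2))" using d L
      by (intro mult_left_mono divide_left_mono mult_pos_pos zero_less_power power_mono) auto
    finally have 1: "\<epsilon>\<^sup>2 / (2 * \<phi>) \<le> d / 1024" by simp
    have "t / sqrt (8 * m * L ^ 3) = sqrt ((2 * L / m) / (8 * m * L ^ 3))"
      by (simp only: t_def x_def real_sqrt_divide)
    also have "(2 * L / m) / (8 * m * L ^ 3) = (1 / (2 * (m * L)))\<^sup>2"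
      using L m by (simp add: power2_eq_square power3_eq_cube)
    also have "sqrt \<dots> = 1 / (2 * (m * L))" using L m by (subst real_sqrt_abs) simp
    finally have "\<phi> * (t / sqrt (8 * m * L ^ 3)) = \<phi> * (1 / (2 * (m * L)))" by (rule arg_cong)
    then have 2: "\<epsilon> * t = d / 2" by (simp add: \<epsilon>_def d_def mult.commute)
    have "\<phi> / \<phi>' \<le> 11 / 10" using d phi by (simp add: \<phi>'_def pos_divide_le_eq)
    then have "\<phi> / \<phi>' * (\<epsilon>\<^sup>2 / (2 * \<phi>) + \<epsilon> * t) \<le> 11 / 10 * (d / 1024 + d / 2)"
      using 1 2 d phi by (intro mult_mono) auto
    also have "\<dots> \<le> 3 / 4 * d" using d by simp
    also have "\<dots> = \<phi>\<^sub>1 - \<phi>'" by (simp add: \<phi>\<^sub>1_def \<phi>'_def \<mu>_def)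
    finally show ?thesis .
  qed
  have slack: "cos \<phi>\<^sub>1 \<le> cos \<theta> * cos \<phi>' - sin \<theta> * (t * sin \<phi>)" if "0 \<le> \<theta>" "\<theta> \<le> \<epsilon>" for \<theta>
    by (rule two_scale_slack[OF phi'(1-3) phi(2) that refl _ gap]) (use x in \<open>simp add: t_def\<close>)
  have psi: "0 < \<psi>" "\<psi> \<le> \<phi>" "sin \<psi> = sin \<phi> * sqrt (1 - x)"
  proof -
    have b: "0 < sin \<phi> * sqrt (1 - x)" using s\<phi> x by simp
    have b2: "sin \<phi> * sqrt (1 - x) \<le> sin \<phi>" using s\<phi> x by (simp add: mult_left_le)
    have b3: "- 1 \<le> sin \<phi> * sqrt (1 - x)" "sin \<phi> * sqrt (1 - x) \<le> 1" "\<bar>sin \<phi> * sqrt (1 - x)\<bar> \<le> 1"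
      using b b2 s\<phi> by linarith+
    show "sin \<psi> = sin \<phi> * sqrt (1 - x)" unfolding \<psi>_def using b3 by (intro sin_arcsin)
    show "0 < \<psi>" unfolding \<psi>_def using arcsin_less_mono[of 0 "sin \<phi> * sqrt (1 - x)"] b b3
      by (simp del: zero_less_mult_iff)
    have "\<psi> \<le> arcsin (sin \<phi>)" unfolding \<psi>_def using b2 b3 s\<phi> by (intro arcsin_le_mono[THEN iffD2]) auto
    then show "\<psi> \<le> \<phi>" using phi by (simp add: arcsin_sin)
  qed
  have cospsi: "(cos \<psi>)\<^sup>2 = (cos \<phi>)\<^sup>2 + (t * sin \<phi>)\<^sup>2"
    using x by (simp add: cos_squared_eq psi(3) power_mult_distrib t_def algebra_simps)
  have bet: "0 < \<beta>" "\<beta> \<le> 1" "\<beta> * \<l> = 1 / 2"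
  proof -
    have "0 \<le> 4 * ln L" using L by simp
    moreover have "2 * \<l> = L + 4 * ln L + 28 / 5" by (simp add: \<l>_def)
    ultimately have "1 \<le> 2 * \<l>" using L by linarith
    then show "0 < \<beta>" "\<beta> \<le> 1" "\<beta> * \<l> = 1 / 2" by (auto simp: \<beta>_def)
  qed
  have gam: "1 \<le> \<gamma>" using par(3) L by (simp add: \<gamma>_def)
  have Vpos: "0 < ?V \<phi>'" "0 < ?V \<phi>" "0 < ?V (\<epsilon> / 2)" "0 < ?V (\<mu> / 2)" "0 < ?V \<psi>" "?V \<phi>\<^sub>1 \<le> 1" "?V \<phi> \<le> 1" "?V \<phi>' \<le> 1" "?V \<phi>' \<le> ?V \<phi>\<^sub>1"
  proof -
    show "0 < ?V \<phi>'" "0 < ?V \<phi>" "0 < ?V (\<epsilon> / 2)" "0 < ?V (\<mu> / 2)" "0 < ?V \<psi>"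
      by (rule cap_fraction_pos[OF dim2]; use phi phi' eps psi in linarith)+
    show "?V \<phi>\<^sub>1 \<le> 1" "?V \<phi> \<le> 1" "?V \<phi>' \<le> 1"
      by (rule cap_fraction_le_1[OF dim2]; use phi phi' in linarith)+
    show "?V \<phi>' \<le> ?V \<phi>\<^sub>1" using phi' by (intro cap_fraction_mono[OF dim2])
  qed
  have ratio: "?V \<phi> \<le> L / (L - 1) * ?V \<phi>'"
  proof -
    have q: "\<phi>' / \<phi> = 1 - 1 / (m * L)" using phi mL by (simp add: \<phi>'_def d_def field_simps)
    have "1 / (m * L) \<le> 1" using mL by simp
    then have "1 - m * (1 / (m * L)) \<le> (1 - 1 / (m * L)) ^ n"
      using Bernoulli_inequality[of "- (1 / (m * L))" n] by (simp add: m_def)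
    then have "(L - 1) / L \<le> (\<phi>' / \<phi>) ^ n" unfolding q using m L by (simp add: field_simps)
    then have "(\<phi> / \<phi>') ^ n \<le> L / (L - 1)" using L phi phi' by (simp add: power_divide field_simps)
    then have "(\<phi> / \<phi>') ^ n * ?V \<phi>' \<le> L / (L - 1) * ?V \<phi>'" using Vpos by (intro mult_right_mono) auto
    moreover have "?V \<phi> \<le> (\<phi> / \<phi>') ^ n * ?V \<phi>'"
      using cap_fraction_ratio_angle[OF dim n2 phi'(1,8) phi(2)] .
    ultimately show ?thesis by simp
  qed
  have Vpsi: "?V \<psi> \<le> ?V \<phi> / m"
  proof -
    have "sqrt (1 - x) \<le> exp (- x / 2)"
    proof (rule real_le_lsqrt)
      have "1 - x \<le> exp (- x)" using exp_ge_add_one_self[of "- x"] by simp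
      also have "\<dots> = (exp (- x / 2))\<^sup>2" by (simp flip: exp_double)
      finally show "1 - x \<le> (exp (- x / 2))\<^sup>2" .
    qed (use x in auto)
    then have "sqrt (1 - x) ^ n \<le> exp (- x / 2) ^ n" using x by (intro power_mono) auto
    also have "\<dots> = exp (m * (- x / 2))" by (simp add: m_def flip: exp_of_nat_mult)
    also have "m * (- x / 2) = - L" using m by (simp add: x_def)
    also have "exp (- L) = 1 / m" by (simp add: m exp_minus field_simps)
    finally have "sqrt (1 - x) ^ n * ?V \<phi> \<le> 1 / m * ?V \<phi>" using Vpos by (intro mult_right_mono) auto
    moreover have "?V \<psi> \<le> (sin \<psi> / sin \<phi>) ^ n * ?V \<phi>"
      using n2 by (intro cap_fraction_ratio_sin[OF dim _ psi(1,2) phi(2)]) auto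
    ultimately show ?thesis using s\<phi> by (simp add: psi(3))
  qed
  define N where "N = nat \<lceil>m * \<l> / ?V \<phi>'\<rceil>"
  have "0 \<le> m * \<l> / ?V \<phi>'" using m par(2) Vpos by simp
  then have N: "m * \<l> / ?V \<phi>' \<le> real N" "real N \<le> m * \<l> / ?V \<phi>' + 1"
    unfolding N_def by linarith+
  have NV': "m * \<l> \<le> real N * ?V \<phi>'" using N(1) Vpos by (simp add: pos_divide_le_eq)
  have NV: "real N * ?V \<phi> \<le> m * (\<l> * (L / (L - 1))) + 1"
  proof -
    have "real N * ?V \<phi> \<le> (m * \<l> / ?V \<phi>' + 1) * ?V \<phi>" using N(2) Vpos by (intro mult_right_mono) auto
    also have "\<dots> = m * \<l> / ?V \<phi>' * ?V \<phi> + ?V \<phi>" by (simp add: algebra_simps)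
    also have "\<dots> \<le> m * \<l> / ?V \<phi>' * (L / (L - 1) * ?V \<phi>') + 1"
      using ratio Vpos m par(2) by (intro add_mono mult_left_mono) auto
    also have "\<dots> = m * (\<l> * (L / (L - 1))) + 1" using Vpos by simp
    finally show ?thesis .
  qed
  obtain X :: "'a set" where X: "finite X" "X \<subseteq> sphere 0 1" "\<And>u. u \<in> sphere 0 1 \<Longrightarrow> \<exists>x\<in>X. cos \<phi> \<le> u \<bullet> x" and
    card: "real (card X) \<le> real N
       + \<beta> powr (- (m / 2)) * (1 - (1 - \<beta>) * ?V \<phi>') ^ N / ?V (\<epsilon> / 2)
       + \<gamma> powr (- (m / 2)) * (1 - ?V \<phi>\<^sub>1 + \<gamma> * ?V \<psi>) ^ N / ?V (\<mu> / 2)"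
    by (rule two_scale_covering[OF dim2 eps(1) phi'(5) _ phi'(1,2,4) phi(2) _ slack psi(1) _ cospsi bet(1,2) gam, of N "m / 2"])
      (use eps phi' psi phi x s\<phi> in \<open>auto simp: t_def\<close>)
  have coarse: "\<beta> powr (- (m / 2)) * (1 - (1 - \<beta>) * ?V \<phi>') ^ N / ?V (\<epsilon> / 2) * ?V \<phi> \<le> 1"
  proof -
    have "?V \<phi> \<le> (\<phi> / (\<epsilon> / 2)) ^ n * ?V (\<epsilon> / 2)"
      using eps phi by (intro cap_fraction_ratio_angle[OF dim n2]) auto
    also have "\<phi> / (\<epsilon> / 2) = sqrt (32 * m * L ^ 3)"
    proof -
      have "32 * m * L ^ 3 = 2\<^sup>2 * (8 * m * L ^ 3)" by simp
      then have "sqrt (32 * m * L ^ 3) = 2 * sqrt (8 * m * L ^ 3)" by (simp only: real_sqrt_mult real_sqrt_abs abs_numeral)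
      then show ?thesis using phi mL3 by (simp add: \<epsilon>_def)
    qed
    also have "\<dots> = exp (ln (32 * m * L ^ 3) / 2)"
    proof -
      have "sqrt y = exp (ln y / 2)" if "0 < y" for y :: real
        using that powr_half_sqrt[of y] by (simp add: powr_def)
      then show ?thesis using mL3 by simp
    qed
    also have "\<dots> ^ n = exp (m * (ln (32 * m * L ^ 3) / 2))" by (simp add: m_def flip: exp_of_nat_mult)
    finally have 1: "?V \<phi> / ?V (\<epsilon> / 2) \<le> exp (m * (ln (32 * m * L ^ 3) / 2))"
      using Vpos by (simp add: pos_divide_le_eq)
    have 2: "\<beta> powr (- (m / 2)) = exp (m * (ln (2 * \<l>) / 2))"
      using par(2) by (simp add: powr_def \<beta>_def ln_div)
    have "(1 - (1 - \<beta>) * ?V \<phi>') ^ N \<le> exp (- (real N * ((1 - \<beta>) * ?V \<phi>')))"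
      using bet Vpos by (intro one_minus_power_le_exp mult_le_one) auto
    also have "\<dots> \<le> exp (m * (- (\<l> - 1 / 2)))"
    proof -
      have "(1 - \<beta>) * (m * \<l>) \<le> (1 - \<beta>) * (real N * ?V \<phi>')" using NV' bet by (intro mult_left_mono) auto
      also have "\<dots> = real N * ((1 - \<beta>) * ?V \<phi>')" by simp
      finally have "(1 - \<beta>) * (m * \<l>) \<le> real N * ((1 - \<beta>) * ?V \<phi>')" .
      moreover have "(1 - \<beta>) * (m * \<l>) = m * (\<l> - \<beta> * \<l>)" by (simp add: algebra_simps)
      ultimately have "m * (\<l> - 1 / 2) \<le> real N * ((1 - \<beta>) * ?V \<phi>')" by (simp only: bet(3))
      then show ?thesis by (simp only: exp_le_cancel_iff mult_minus_right neg_le_iff_le)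
    qed
    finally have 3: "(1 - (1 - \<beta>) * ?V \<phi>') ^ N \<le> exp (m * (- (\<l> - 1 / 2)))" .
    have 4: "0 \<le> (1 - (1 - \<beta>) * ?V \<phi>') ^ N"
      using bet Vpos mult_le_one[of "1 - \<beta>" "?V \<phi>'"] by simp
    have "\<beta> powr (- (m / 2)) * (1 - (1 - \<beta>) * ?V \<phi>') ^ N / ?V (\<epsilon> / 2) * ?V \<phi>
       = \<beta> powr (- (m / 2)) * (1 - (1 - \<beta>) * ?V \<phi>') ^ N * (?V \<phi> / ?V (\<epsilon> / 2))" by simp
    also have "\<dots> \<le> exp (m * (ln (2 * \<l>) / 2)) * exp (m * (- (\<l> - 1 / 2))) * exp (m * (ln (32 * m * L ^ 3) / 2))"
      unfolding 2 using 1 3 4 Vpos by (intro mult_mono) auto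
    also have "\<dots> = exp (m * (ln (32 * m * L ^ 3) / 2 + ln (2 * \<l>) / 2 + 1 / 2 - \<l>))"
      by (simp add: algebra_simps flip: exp_add)
    also have "\<dots> \<le> exp 0" using par(5) m by (intro exp_le_cancel_iff[THEN iffD2] mult_nonneg_nonpos) auto
    finally show ?thesis by simp
  qed
  have fine: "\<gamma> powr (- (m / 2)) * (1 - ?V \<phi>\<^sub>1 + \<gamma> * ?V \<psi>) ^ N / ?V (\<mu> / 2) * ?V \<phi> \<le> 1"
  proof -
    have "?V \<phi> \<le> (\<phi> / (\<mu> / 2)) ^ n * ?V (\<mu> / 2)"
      using phi phi' by (intro cap_fraction_ratio_angle[OF dim n2]) auto
    also have "\<phi> / (\<mu> / 2) = exp (ln (8 * m * L))" using phi m L by (simp add: \<mu>_def d_def)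
    also have "\<dots> ^ n = exp (m * ln (8 * m * L))" by (simp only: m_def flip: exp_of_nat_mult)
    finally have 1: "?V \<phi> / ?V (\<mu> / 2) \<le> exp (m * ln (8 * m * L))"
      using Vpos by (simp add: pos_divide_le_eq)
    have 2: "\<gamma> powr (- (m / 2)) = exp (m * (- ln (m / (3 * L)) / 2))"
      using m L by (simp add: powr_def \<gamma>_def)
    have "real N * (\<gamma> * ?V \<psi>) \<le> real N * (\<gamma> * (?V \<phi> / m))"
      using Vpsi gam by (intro mult_left_mono) auto
    also have "\<dots> = real N * ?V \<phi> / (3 * L)" using m by (simp add: \<gamma>_def)
    also have "\<dots> \<le> (m * (\<l> * (L / (L - 1))) + 1) / (3 * L)" using NV L by (intro divide_right_mono) auto
    also have "\<dots> \<le> m"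
    proof -
      have "\<l> * (L / (L - 1)) \<le> (3 / 2 * L) * (8 / 7)"
        using par(1,2) L by (intro mult_mono) (auto simp: divide_le_eq)
      then have "m * (\<l> * (L / (L - 1))) \<le> m * ((3 / 2 * L) * (8 / 7))" using m by (intro mult_left_mono) auto
      also have "\<dots> = 12 / 7 * (m * L)" by simp
      finally have "m * (\<l> * (L / (L - 1))) + 1 \<le> 3 * (m * L)" using mL by linarith
      then have "m * (\<l> * (L / (L - 1))) + 1 \<le> m * (3 * L)" by (simp only: mult.left_commute)
      then show ?thesis using L by (simp only: pos_divide_le_eq)
    qed
    finally have "real N * (\<gamma> * ?V \<psi>) \<le> m" .
    moreover have "real N * ?V \<phi>' \<le> real N * ?V \<phi>\<^sub>1" using Vpos by (intro mult_left_mono) auto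
    ultimately have "m * \<l> - m \<le> real N * (?V \<phi>\<^sub>1 - \<gamma> * ?V \<psi>)" using NV' by (simp add: right_diff_distrib)
    moreover have "(1 - (?V \<phi>\<^sub>1 - \<gamma> * ?V \<psi>)) ^ N \<le> exp (- (real N * (?V \<phi>\<^sub>1 - \<gamma> * ?V \<psi>)))"
    proof (rule one_minus_power_le_exp)
      have "0 \<le> \<gamma> * ?V \<psi>" using gam Vpos by simp
      then show "?V \<phi>\<^sub>1 - \<gamma> * ?V \<psi> \<le> 1" using Vpos by linarith
    qed
    moreover have "m * (1 - \<l>) = - (m * \<l> - m)" by (simp add: algebra_simps)
    moreover have "1 - ?V \<phi>\<^sub>1 + \<gamma> * ?V \<psi> = 1 - (?V \<phi>\<^sub>1 - \<gamma> * ?V \<psi>)" by simp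
    ultimately have 3: "(1 - ?V \<phi>\<^sub>1 + \<gamma> * ?V \<psi>) ^ N \<le> exp (m * (1 - \<l>))"
      by (metis exp_le_cancel_iff neg_le_iff_le order_trans)
    have 4: "0 \<le> (1 - ?V \<phi>\<^sub>1 + \<gamma> * ?V \<psi>) ^ N"
      using gam Vpos by (intro zero_le_power add_nonneg_nonneg mult_nonneg_nonneg) auto
    have "\<gamma> powr (- (m / 2)) * (1 - ?V \<phi>\<^sub>1 + \<gamma> * ?V \<psi>) ^ N / ?V (\<mu> / 2) * ?V \<phi>
       = \<gamma> powr (- (m / 2)) * (1 - ?V \<phi>\<^sub>1 + \<gamma> * ?V \<psi>) ^ N * (?V \<phi> / ?V (\<mu> / 2))" by simp
    also have "\<dots> \<le> exp (m * (- ln (m / (3 * L)) / 2)) * exp (m * (1 - \<l>)) * exp (m * ln (8 * m * L))"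
      unfolding 2 using 1 3 4 Vpos by (intro mult_mono) auto
    also have "\<dots> = exp (m * (ln (8 * m * L) - ln (m / (3 * L)) / 2 + 1 - \<l>))"
      by (simp add: algebra_simps flip: exp_add)
    also have "\<dots> \<le> exp 0" using par(6) m by (intro exp_le_cancel_iff[THEN iffD2] mult_nonneg_nonpos) auto
    finally show ?thesis by simp
  qed
  have "real (card X) * ?V \<phi> \<le> (real N
       + \<beta> powr (- (m / 2)) * (1 - (1 - \<beta>) * ?V \<phi>') ^ N / ?V (\<epsilon> / 2)
       + \<gamma> powr (- (m / 2)) * (1 - ?V \<phi>\<^sub>1 + \<gamma> * ?V \<psi>) ^ N / ?V (\<mu> / 2)) * ?V \<phi>"
    using card Vpos by (intro mult_right_mono) auto
  also have "\<dots> \<le> m * (\<l> * (L / (L - 1))) + 1 + 1 + 1"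
    unfolding distrib_right using NV coarse fine by (intro add_mono)
  also have "\<dots> \<le> m * (L / 2 + 3 * ln L + 3)" using par(7) by simp
  finally show ?thesis using that X by (simp add: m_def L_def)
qed

section \<open>From caps to unit balls\<close>

lemma cos_arcsin_inverse:
  fixes r :: real
  assumes "r > 1"
  shows "cos (arcsin (1 / r)) = sqrt (r\<^sup>2 - 1) / r"
proof -
  have "1 - (1 / r)\<^sup>2 = (r\<^sup>2 - 1) / r\<^sup>2" using assms by (simp add: power_divide diff_divide_distrib)
  moreover have "- 1 \<le> 1 / r" "1 / r \<le> 1" using assms by (auto simp: le_divide_eq)
  ultimately show ?thesis using assms by (simp only: cos_arcsin) (simp add: real_sqrt_divide)
qed

lemma arcsin_inverse_range:
  fixes r :: real
  assumes "r > 1"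
  shows "0 < arcsin (1 / r)" "arcsin (1 / r) < pi / 2"
proof -
  have r: "0 < 1 / r" "1 / r < 1" using assms by auto
  show "0 < arcsin (1 / r)" using arcsin_less_mono[of 0 "1 / r"] r by simp
  show "arcsin (1 / r) < pi / 2" using arcsin_less_mono[of "1 / r" 1] r by simp
qed

text \<open>
  As \<open>q\<^sup>2 = r\<^sup>2 - 1\<close>, the squared distance is \<open>1 + 2 * q * (q - z \<bullet> y)\<close>.
\<close>

lemma mem_ball_iff_inner:
  fixes y z :: "'a::euclidean_space"
  assumes q: "q > 0" "q\<^sup>2 = r\<^sup>2 - 1" and y: "norm y = 1" and z: "norm z = r"
  shows "z \<in> cball (q *\<^sub>R y) 1 \<longleftrightarrow> q \<le> z \<bullet> y"
proof -
  have "(dist (q *\<^sub>R y) z)\<^sup>2 = (norm (q *\<^sub>R y))\<^sup>2 - 2 * ((q *\<^sub>R y) \<bullet> z) + (norm z)\<^sup>2"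
    unfolding dist_norm power2_norm_eq_inner by (simp add: inner_diff_left inner_diff_right inner_commute)
  also have "\<dots> = 1 + 2 * q * (q - z \<bullet> y)"
    using q z y by (simp add: power_mult_distrib inner_commute[of y] algebra_simps power2_eq_square)
  finally have "dist (q *\<^sub>R y) z \<le> 1 \<longleftrightarrow> 2 * q * (q - z \<bullet> y) \<le> 0"
    using abs_le_square_iff[of "dist (q *\<^sub>R y) z" 1] by simp
  also have "\<dots> \<longleftrightarrow> q \<le> z \<bullet> y" using q(1) by (simp add: mult_le_0_iff)
  finally show ?thesis by simp
qed

text \<open>
  The cone over the cap, whose volume defines the surface measure, is the \<open>r\<close>-fold of a solid cone
  in the unit ball, up to the apex.
\<close>

lemma surface_fraction_unit_ball:
  fixes x :: "'a::euclidean_space"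
  assumes dim: "DIM('a) \<ge> 2" and r: "r > 1" and x: "norm x = sqrt (r\<^sup>2 - 1)"
  shows "surface_measure r (cball x 1 \<inter> sphere 0 r) / surface_measure r (sphere 0 r :: 'a set)
    = cap_fraction TYPE('a) (arcsin (1 / r))"
proof -
  define \<phi> where "\<phi> = arcsin (1 / r)"
  define q where "q = sqrt (r\<^sup>2 - 1)"
  have r2: "r\<^sup>2 > 1" using r by (simp add: power2_eq_square less_1_mult)
  then have q: "q > 0" "q\<^sup>2 = r\<^sup>2 - 1" by (simp_all add: q_def)
  have phi: "0 < \<phi>" "\<phi> < pi / 2"
    using arcsin_inverse_range[OF r] by (auto simp: \<phi>_def)
  have cos: "cos \<phi> = q / r"
    using cos_arcsin_inverse[OF r] by (simp add: \<phi>_def q_def)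
  define y where "y = (1 / q) *\<^sub>R x"
  have y: "norm y = 1" "x = q *\<^sub>R y" using x q by (auto simp: y_def q_def)
  let ?C = "{p \<in> cball 0 1. cos \<phi> * norm p \<le> p \<bullet> y}"
  have mem: "z \<in> cball x 1 \<longleftrightarrow> cos \<phi> * r \<le> z \<bullet> y" if "norm z = r" for z
    unfolding y(2) using mem_ball_iff_inner[OF q y(1) that] r by (simp add: cos)
  have cone: "{t *\<^sub>R z | t z. 0 < t \<and> t \<le> 1 \<and> z \<in> cball x 1 \<inter> sphere 0 r} = (\<lambda>p. r *\<^sub>R p) ` ?C - {0}"
    (is "?L = _")
  proof (intro equalityI subsetI)
    fix v assume "v \<in> ?L"
    then obtain t z where t: "v = t *\<^sub>R z" "0 < t" "t \<le> 1" "z \<in> cball x 1" "norm z = r" by auto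
    then have "t * (cos \<phi> * r) \<le> t * (z \<bullet> y)" using mem[of z] by (intro mult_left_mono) auto
    then have "t * (cos \<phi> * r) / r \<le> t * (z \<bullet> y) / r" using r by (intro divide_right_mono) auto
    then have "(1 / r) *\<^sub>R v \<in> ?C" using t r by (simp add: mult.commute)
    moreover have "v = r *\<^sub>R ((1 / r) *\<^sub>R v)" "v \<noteq> 0" using r t by auto
    ultimately show "v \<in> (\<lambda>p. r *\<^sub>R p) ` ?C - {0}" by blast
  next
    fix v assume "v \<in> (\<lambda>p. r *\<^sub>R p) ` ?C - {0}"
    then obtain p where p: "v = r *\<^sub>R p" "p \<noteq> 0" "norm p \<le> 1" "cos \<phi> * norm p \<le> p \<bullet> y" using r by auto
    define z where "z = (r / norm p) *\<^sub>R p"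
    have nz: "norm z = r" using p r by (simp add: z_def)
    have "cos \<phi> * r \<le> z \<bullet> y"
      using p r by (simp add: z_def field_simps)
    then have "z \<in> cball x 1 \<inter> sphere 0 r" using mem nz by auto
    moreover have "v = norm p *\<^sub>R z" using p by (simp add: z_def)
    ultimately show "v \<in> ?L" using p by (intro CollectI exI[of _ "norm p"] exI[of _ z]) auto
  qed
  obtain b :: 'a where b: "b \<in> Basis" using nonempty_Basis by blast
  have [measurable]: "?C \<in> sets borel" by measurable
  have "measure lebesgue ?L = measure lebesgue ((\<lambda>p. r *\<^sub>R p) ` ?C)"
    unfolding cone
  proof (rule measure_negligible_symdiff)
    have "closed ?C"
      unfolding mem_cball by (intro closed_Collect_conj closed_Collect_le continuous_intros)
    moreover have "?C \<subseteq> cball 0 1" by auto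
    ultimately have "compact ?C" by (meson bounded_cball bounded_subset compact_eq_bounded_closed)
    then show "(\<lambda>p. r *\<^sub>R p) ` ?C \<in> lmeasurable"
      by (intro lmeasurable_compact compact_scaling)
  qed (auto intro: negligible_subset[of "{0}"])
  also have "\<dots> = r ^ DIM('a) * measure lebesgue ?C"
    using measure_lebesgue_affine[where m = r and \<delta> = "0 :: 'a" and S = ?C] r by simp
  also have "measure lebesgue ?C = measure lborel ?C" by (simp add: measure_completion)
  also have "\<dots> = measure lborel {p \<in> cball 0 1. cos \<phi> * norm p \<le> p \<bullet> b}"
    using y b by (intro measure_solid_cone_rotate) auto
  also have "\<dots> = cap_volume (DIM('a) - 1) \<phi>"
    using b phi dim by (intro measure_solid_cone) auto
  finally have "surface_measure r (cball x 1 \<inter> sphere 0 r) = real DIM('a) / r * (r ^ DIM('a) * cap_volume (DIM('a) - 1) \<phi>)"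
    by (simp add: surface_measure_def)
  moreover have "surface_measure r (sphere 0 r :: 'a set) = real DIM('a) / r * (r ^ DIM('a) * unit_ball_vol (real DIM('a)))"
  proof -
    have "r ^ DIM('a) = r * r ^ (DIM('a) - 1)" by (metis DIM_positive power_eq_if not_less_zero)
    then show ?thesis using surface_measure_sphere[where 'a = 'a, of r] r by simp
  qed
  ultimately show ?thesis
    using r by (simp add: cap_fraction_def content_cball \<phi>_def)
qed

lemma min_covering_density_le_caps:
  fixes X :: "'a::euclidean_space set"
  assumes dim: "DIM('a) \<ge> 2" and r: "r > 1" and X: "finite X" "X \<subseteq> sphere 0 1"
    and cover: "\<And>u. u \<in> sphere 0 1 \<Longrightarrow> \<exists>x\<in>X. cos (arcsin (1 / r)) \<le> u \<bullet> x"
  shows "min_covering_density TYPE('a) r \<le> real (card X) * cap_fraction TYPE('a) (arcsin (1 / r))"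
proof -
  define q where "q = sqrt (r\<^sup>2 - 1)"
  have r2: "r\<^sup>2 > 1" using r by (simp add: power2_eq_square less_1_mult)
  then have q: "q > 0" "q\<^sup>2 = r\<^sup>2 - 1" by (simp_all add: q_def)
  have cos: "cos (arcsin (1 / r)) = q / r"
    using cos_arcsin_inverse[OF r] by (simp add: q_def)
  define Cov where "Cov = (\<lambda>x. q *\<^sub>R x) ` X"
  have norms: "norm x = sqrt (r\<^sup>2 - 1)" if "x \<in> Cov" for x
    using that X(2) q by (auto simp: Cov_def q_def)
  have "unit_covering r Cov"
    unfolding unit_covering_def
  proof (intro conjI ballI subsetI)
    show "finite Cov" using X by (simp add: Cov_def)
  next
    fix z :: 'a assume z: "z \<in> sphere 0 r"
    then have "(1 / r) *\<^sub>R z \<in> sphere 0 1" using r by simp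
    from cover[OF this] obtain x where x: "x \<in> X" "q / r \<le> (z \<bullet> x) / r" by (auto simp: cos)
    then have qz: "q \<le> z \<bullet> x" using r by (simp add: divide_le_cancel)
    have "norm x = 1" "norm z = r" using x(1) X(2) z by auto
    then have "z \<in> cball (q *\<^sub>R x) 1" using mem_ball_iff_inner[OF q] qz by blast
    then show "z \<in> (\<Union>x\<in>Cov. cball x 1)" using x(1) by (auto simp: Cov_def)
  qed (rule norms)
  moreover have "bdd_below (covering_density r ` {Cov :: 'a set. unit_covering r Cov})"
  proof (rule bdd_belowI[of _ 0])
    fix d assume "d \<in> covering_density r ` {Cov :: 'a set. unit_covering r Cov}"
    then show "0 \<le> d" using r by (auto simp: covering_density_def surface_measure_def intro!: sum_nonneg)
  qed
  ultimately have "min_covering_density TYPE('a) r \<le> covering_density r Cov"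
    unfolding min_covering_density_def by (intro cINF_lower) auto
  also have "\<dots> = real (card Cov) * cap_fraction TYPE('a) (arcsin (1 / r))"
    unfolding covering_density_def using surface_fraction_unit_ball[OF dim r norms] by simp
  also have "\<dots> \<le> real (card X) * cap_fraction TYPE('a) (arcsin (1 / r))"
  proof (rule mult_right_mono)
    show "real (card Cov) \<le> real (card X)" using X by (simp add: Cov_def card_image_le)
    show "0 \<le> cap_fraction TYPE('a) (arcsin (1 / r))"
      using cap_fraction_pos[OF dim arcsin_inverse_range[OF r]] by simp
  qed
  finally show ?thesis .
qed

theorem theorem1:
  fixes n :: nat and r :: real
  assumes "n \<ge> 3" and "r > 1" and "DIM('a::euclidean_space) = n + 1"
  shows "min_covering_density TYPE('a) r
           \<le> (1 / 2 + 3 * ln (ln (real n)) / ln (real n) + 3 / ln (real n)) * real n * ln (real n)"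
proof -
  define \<phi> where "\<phi> = arcsin (1 / r)"
  have phi: "0 < \<phi>" "\<phi> < pi / 2" using arcsin_inverse_range[OF assms(2)] by (simp_all add: \<phi>_def)
  have dim2: "DIM('a) \<ge> 2" and n2: "n \<ge> 2" using assms by simp_all
  obtain X :: "'a set" where X: "finite X" "X \<subseteq> sphere 0 1"
    "\<And>u. u \<in> sphere 0 1 \<Longrightarrow> \<exists>x\<in>X. cos \<phi> \<le> u \<bullet> x"
    and density: "real (card X) * cap_fraction TYPE('a) \<phi>
      \<le> real n * (ln (real n) / 2 + 3 * ln (ln (real n)) + 3)"
  proof (cases "8 \<le> ln (real n)")
    case True
    show ?thesis
      by (rule large_dimension_density[OF assms(3) True phi]) (use that in auto)
  next
    case False
    then have "ln (real n) \<le> 8" by simp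
    with assms(1) obtain \<eta> where \<eta>: "0 < \<eta>" "\<eta> \<le> 1 / 2"
      "(1 / (1 - \<eta>)) ^ n * (1 + real n * ln ((1 - \<eta>) / \<eta>)) + 1
        \<le> real n * (ln (real n) / 2 + 3 * ln (ln (real n)) + 3)"
      by (rule small_dimension_density)
    show ?thesis
      by (rule one_scale_density[OF assms(3) n2 phi \<eta>(1,2)]) (use that \<eta>(3) order_trans in blast)
  qed
  have "min_covering_density TYPE('a) r \<le> real (card X) * cap_fraction TYPE('a) \<phi>"
    unfolding \<phi>_def
    by (rule min_covering_density_le_caps[OF dim2 assms(2) X(1,2)]) (use X(3) in \<open>simp add: \<phi>_def\<close>)
  also note density
  also have "real n * (ln (real n) / 2 + 3 * ln (ln (real n)) + 3)
      = (1 / 2 + 3 * ln (ln (real n)) / ln (real n) + 3 / ln (real n)) * real n * ln (real n)"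
  proof -
    have "ln (real n) > 0" using assms(1) by simp
    then show ?thesis by (simp add: field_simps)
  qed
  finally show ?thesis .
qed

end
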